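(* Let $\mathcal{H}$ be a real Hilbert space with $\dim\mathcal{H}\ge 1$. For $(\alpha,\beta,\theta)\in\mathbb{R}_{++}^2\times(\mathbb{R}\setminus\{0\})$, the extended Douglas--Rachford algorithm converges unconditionally for $(\alpha,\beta,\theta)$ over $\partial\mathcal{F}\times\partial\mathcal{F}$ if and only if $\theta\in(0,\min\{2,2\alpha/\beta\})$. Moreover, $$S(\partial\mathcal{F}\times\partial\mathcal{F})=S(\partial\mathcal{F}\times\mathcal{A})=S^{(1)}\cup S^{(2)}.$$
   Context: $\mathbb{R}_{++}$ denotes the positive reals. $\mathcal{A}$ is the set of maximally monotone operators $A:\mathcal{H}\rightrightarrows\mathcal{H}$; $\mathcal{F}$ is the set of proper, closed (lower semicontinuous), convex functions $f:\mathcal{H}\to\mathbb{R}\cup\{+\infty\}$; $\partial\mathcal{F}=\{\partial f: f\in\mathcal{F}\}\subset\mathcal{A}$, where $\partial f$ is the convex subdifferential. For $A\in\mathcal{A}$ and $\alpha>0$, $J_{\alpha A}=(\mathrm{Id}+\alpha A)^{-1}:\mathcal{H}\to\mathcal{H}$ is the (single-valued, everywhere defined) resolvent. $\operatorname{zer}(A+B)=\{x\in\mathcal{H}: 0\in A(x)+B(x)\}$. Extended Douglas--Rachford algorithm: applied to $(A,B,z^0,\alpha,\beta,\theta)\in\mathcal{A}\times\mathcal{A}\times\mathcal{H}\times\mathbb{R}_{++}\times\mathbb{R}_{++}\times(\mathbb{R}\setminus\{0\})$, it generates $\bigl((x_1^k,x_2^k,z^k)\bigr)_{k\in\mathbb{N}}$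 by, for $k=0,1,2,\dots$, $$x_1^k=J_{\alpha A}(z^k),\quad x_2^k=J_{\beta B}\Bigl(\bigl(1+\tfrac{\beta}{\alpha}\bigr)x_1^k-\tfrac{\beta}{\alpha}z^k\Bigr),\quad z^{k+1}=z^k+\theta(x_2^k-x_1^k).$$ Fixed points: $\operatorname{Fix}(A,B,\alpha,\beta)=\{(x^\star,x^\star,z^\star)\in\mathcal{H}^3: x^\star=J_{\alpha A}(z^\star)=J_{\beta B}((1+\frac{\beta}{\alpha})x^\star-\frac{\beta}{\alpha}z^\star)\}$. Unconditional convergence: for $\mathcal{C}\subset\mathcal{A}\times\mathcal{A}$, the algorithm converges unconditionally for $(\alpha,\beta,\theta)\in\mathbb{R}_{++}^2\times(\mathbb{R}\setminus\{0\})$ over $\mathcal{C}$ if, for every $z^0\in\mathcal{H}$ and every $(A,B)\in\mathcal{C}$ with $\operatorname{zer}(A+B)\ne\emptyset$, the sequence $\bigl((x_1^k,x_2^k,z^k)\bigr)_{k\in\mathbb{N}}$ generated by the algorithm applied to $(A,B,z^0,\alpha,\beta,\theta)$ converges weakly to a point $(x^\star,x^\star,z^\star)\in\operatorname{Fix}(A,B,\alpha,\beta)$. $S(\mathcal{C})$ is the set of all $(\alpha,\beta,\theta)\in\mathbb{R}_{++}^2\times(\mathbb{R}\setminus\{0\})$ for which the algorithm converges unconditionally over $\mathcal{C}$. Parameter sets: $S^{(1)}=\{(\alpha,\beta,\theta)\in\mathbb{R}_{++}^3:\alpha/\beta\in(0,1],\ \theta\in(0,2\alpha/\beta)\}$,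 $S^{(2)}=\{(\alpha,\beta,\theta)\in\mathbb{R}_{++}^3:\alpha/\beta\in[1,+\infty),\ \theta\in(0,2)\}$. *)

theory Defs
  imports "HOL-Analysis.Analysis"
begin

text \<open>A set-valued operator is a map into sets, so equality of operators is equality of graphs and
  \<open>A \<le> B\<close> is inclusion of graphs.\<close>

type_synonym 'a setop = "'a \<Rightarrow> 'a set"

definition monotone_op :: "'a::real_inner setop \<Rightarrow> bool" where
  "monotone_op A \<longleftrightarrow> (\<forall>x y. \<forall>u\<in>A x. \<forall>v\<in>A y. 0 \<le> inner (u - v) (x - y))"

definition maximally_monotone :: "'a::real_inner setop \<Rightarrow> bool" where
  "maximally_monotone A \<longleftrightarrow> monotone_op A \<and> (\<forall>B. monotone_op B \<and> A \<le> B \<longrightarrow> B = A)"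

definition maxmono_ops :: "'a::real_inner setop set" where
  "maxmono_ops = {A. maximally_monotone A}"

definition proper_fun :: "('a \<Rightarrow> ereal) \<Rightarrow> bool" where
  "proper_fun f \<longleftrightarrow> (\<forall>x. f x \<noteq> -\<infinity>) \<and> (\<exists>x. f x \<noteq> \<infinity>)"

definition lsc_fun :: "('a::topological_space \<Rightarrow> ereal) \<Rightarrow> bool" where
  "lsc_fun f \<longleftrightarrow> (\<forall>x. f x \<le> Liminf (at x) f)"

definition convex_fun :: "('a::real_vector \<Rightarrow> ereal) \<Rightarrow> bool" where
  "convex_fun f \<longleftrightarrow> (\<forall>x y. \<forall>t\<in>{0<..<1}.
     f ((1 - t) *\<^sub>R x + t *\<^sub>R y) \<le> ereal (1 - t) * f x + ereal t * f y)"

definition proper_closed_convex :: "('a::real_inner \<Rightarrow> ereal) set" where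
  "proper_closed_convex = {f. proper_fun f \<and> lsc_fun f \<and> convex_fun f}"

definition subdiff :: "('a::real_inner \<Rightarrow> ereal) \<Rightarrow> 'a setop" where
  "subdiff f x = {u. \<forall>y. f x + ereal (inner u (y - x)) \<le> f y}"

definition subdiff_ops :: "'a::real_inner setop set" where
  "subdiff_ops = subdiff ` proper_closed_convex"

definition zer :: "'a::real_inner setop \<Rightarrow> 'a set" where
  "zer A = {x. 0 \<in> A x}"

definition op_add :: "'a::real_inner setop \<Rightarrow> 'a setop \<Rightarrow> 'a setop" where
  "op_add A B x = {u + v | u v. u \<in> A x \<and> v \<in> B x}"

text \<open>\<open>resolvent \<alpha> A z\<close> is the unique \<open>x\<close> with \<open>z \<in> (Id + \<alpha>A)(x)\<close>. For maximally monotone \<open>A\<close> on a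
  Hilbert space and \<open>\<alpha> > 0\<close> it exists and is unique (Minty), so the description is meaningful at
  every \<open>z\<close>.\<close>

definition resolvent :: "real \<Rightarrow> 'a::real_inner setop \<Rightarrow> 'a \<Rightarrow> 'a" where
  "resolvent \<alpha> A z = (THE x. z \<in> {x + \<alpha> *\<^sub>R u | u. u \<in> A x})"

definition edr_x1 :: "'a::real_inner setop \<Rightarrow> real \<Rightarrow> 'a \<Rightarrow> 'a" where
  "edr_x1 A \<alpha> z = resolvent \<alpha> A z"

definition edr_x2 :: "'a::real_inner setop \<Rightarrow> 'a setop \<Rightarrow> real \<Rightarrow> real \<Rightarrow> 'a \<Rightarrow> 'a" where
  "edr_x2 A B \<alpha> \<beta> z = resolvent \<beta> B ((1 + \<beta> / \<alpha>) *\<^sub>R edr_x1 A \<alpha> z - (\<beta> / \<alpha>) *\<^sub>R z)"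

primrec edr_z ::
  "'a::real_inner setop \<Rightarrow> 'a setop \<Rightarrow> 'a \<Rightarrow> real \<Rightarrow> real \<Rightarrow> real \<Rightarrow> nat \<Rightarrow> 'a" where
  "edr_z A B z0 \<alpha> \<beta> \<theta> 0 = z0"
| "edr_z A B z0 \<alpha> \<beta> \<theta> (Suc k) = edr_z A B z0 \<alpha> \<beta> \<theta> k
     + \<theta> *\<^sub>R (edr_x2 A B \<alpha> \<beta> (edr_z A B z0 \<alpha> \<beta> \<theta> k) - edr_x1 A \<alpha> (edr_z A B z0 \<alpha> \<beta> \<theta> k))"

definition edr_seq ::
  "'a::real_inner setop \<Rightarrow> 'a setop \<Rightarrow> 'a \<Rightarrow> real \<Rightarrow> real \<Rightarrow> real \<Rightarrow> nat \<Rightarrow> 'a \<times> 'a \<times> 'a" where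
  "edr_seq A B z0 \<alpha> \<beta> \<theta> k =
     (let z = edr_z A B z0 \<alpha> \<beta> \<theta> k in (edr_x1 A \<alpha> z, edr_x2 A B \<alpha> \<beta> z, z))"

definition edr_Fix ::
  "'a::real_inner setop \<Rightarrow> 'a setop \<Rightarrow> real \<Rightarrow> real \<Rightarrow> ('a \<times> 'a \<times> 'a) set" where
  "edr_Fix A B \<alpha> \<beta> = {(x, x, z) | x z.
     x = resolvent \<alpha> A z \<and> x = resolvent \<beta> B ((1 + \<beta> / \<alpha>) *\<^sub>R x - (\<beta> / \<alpha>) *\<^sub>R z)}"

text \<open>Weak convergence in an inner product space; it is applied below to the Hilbert product
  \<open>'a \<times> 'a \<times> 'a\<close>, whose inner product is the sum of those of the components.\<close>

definition weakly_converges :: "(nat \<Rightarrow> 'a::real_inner) \<Rightarrow> 'a \<Rightarrow> bool" where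
  "weakly_converges X l \<longleftrightarrow> (\<forall>y. (\<lambda>k. inner (X k) y) \<longlonglongrightarrow> inner l y)"

definition converges_unconditionally ::
  "('a::real_inner setop \<times> 'a setop) set \<Rightarrow> real \<Rightarrow> real \<Rightarrow> real \<Rightarrow> bool" where
  "converges_unconditionally C \<alpha> \<beta> \<theta> \<longleftrightarrow>
     (\<forall>z0. \<forall>(A, B)\<in>C. zer (op_add A B) \<noteq> {} \<longrightarrow>
       (\<exists>p\<in>edr_Fix A B \<alpha> \<beta>. weakly_converges (edr_seq A B z0 \<alpha> \<beta> \<theta>) p))"

definition S_conv :: "('a::real_inner setop \<times> 'a setop) set \<Rightarrow> (real \<times> real \<times> real) set" where
  "S_conv C = {(\<alpha>, \<beta>, \<theta>). \<alpha> > 0 \<and> \<beta> > 0 \<and> \<theta> \<noteq> 0 \<and> converges_unconditionally C \<alpha> \<beta> \<theta>}"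

definition S1 :: "(real \<times> real \<times> real) set" where
  "S1 = {(\<alpha>, \<beta>, \<theta>). \<alpha> > 0 \<and> \<beta> > 0 \<and> \<theta> > 0 \<and> \<alpha> / \<beta> \<in> {0<..1} \<and> \<theta> \<in> {0<..<2 * \<alpha> / \<beta>}}"

definition S2 :: "(real \<times> real \<times> real) set" where
  "S2 = {(\<alpha>, \<beta>, \<theta>). \<alpha> > 0 \<and> \<beta> > 0 \<and> \<theta> > 0 \<and> \<alpha> / \<beta> \<in> {1..} \<and> \<theta> \<in> {0<..<2}}"

end

(* Sufficiency. Let (p, q) be a solution, that is, q lies in (subdiff f)(p) and - q in B(p). With
   the subgradient a = (z - x1) / \<alpha> in (subdiff f)(x1), x = x1 - p, the Bregman distance
   D = f(x1) - f(p) - <q, x1 - p> and b = a - q, the Lyapunov function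
     |x + \<alpha> b|^2 + 2 (\<beta> - \<alpha>) D + \<alpha> (\<beta> - \<alpha>) |b|^2
   decreases by at least \<theta> (2 - \<theta> max(1, \<beta>/\<alpha>)) |x1 - x2|^2 in each step and dominates
   |x|^2 + \<alpha> \<beta> |b|^2. Hence the iterates are bounded, x1 - x2 tends to 0, and all weak cluster
   points of (x1, a) are solutions. The Lyapunov functions of two solutions differ by
   2 <z, (p + \<beta> q) - (p' + \<beta> q')> up to sign and a constant, so this inner product converges along
   the iteration; comparing its limits at two weak cluster points (p, q) and (p', q') and using
   monotonicity of the subdifferential shows that they coincide.

   Necessity. For f = 0 and the indicator function of {0}, in the two possible orders, the iteration
   is z \<mapsto> (1 - \<theta>) z and z \<mapsto> (1 - \<theta> \<beta>/\<alpha>) z. *)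

theory Submission
  imports Defs
begin

subsection \<open>Proper closed convex functions and the proximal point\<close>

text \<open>The limit inferior is taken over the punctured filter \<open>at x\<close>; since
  \<open>c < f x\<close> holds at the centre itself, full neighbourhoods may be used
  instead.\<close>

lemma lsc_fun_iff_eventually_nhds:
  "lsc_fun f \<longleftrightarrow> (\<forall>x c. c < f x \<longrightarrow> (\<forall>\<^sub>F y in nhds x. c < f y))"
  unfolding lsc_fun_def le_Liminf_iff eventually_nhds_conv_at by blast

lemma lsc_fun_continuous:
  fixes \<phi> :: "'a::t2_space \<Rightarrow> real"
  assumes "continuous_on UNIV \<phi>"
  shows "lsc_fun (\<lambda>x. ereal (\<phi> x))"
  unfolding lsc_fun_iff_eventually_nhds
proof (intro allI impI)
  fix x c assume c: "c < ereal (\<phi> x)"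
  have "(\<phi> \<longlongrightarrow> \<phi> x) (nhds x)"
    using assms by (simp add: continuous_on_eq_continuous_at isCont_def flip: tendsto_at_iff_tendsto_nhds)
  then have "((\<lambda>y. ereal (\<phi> y)) \<longlongrightarrow> ereal (\<phi> x)) (nhds x)" by (rule tendsto_ereal)
  then show "\<forall>\<^sub>F y in nhds x. c < ereal (\<phi> y)"
    using c by (rule order_tendstoD)
qed

lemma lsc_fun_SUP:
  assumes "\<And>i. i \<in> I \<Longrightarrow> lsc_fun (f i)"
  shows "lsc_fun (\<lambda>x. SUP i\<in>I. f i x)"
  unfolding lsc_fun_iff_eventually_nhds
proof (intro allI impI)
  fix x c assume "c < (SUP i\<in>I. f i x)"
  then obtain i where i: "i \<in> I" "c < f i x" by (auto simp: less_SUP_iff)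
  then have "\<forall>\<^sub>F y in nhds x. c < f i y"
    using assms unfolding lsc_fun_iff_eventually_nhds by blast
  then show "\<forall>\<^sub>F y in nhds x. c < (SUP i\<in>I. f i y)"
    by eventually_elim (use i in \<open>auto simp: less_SUP_iff\<close>)
qed

lemma convex_fun_SUP:
  assumes "\<And>i. i \<in> I \<Longrightarrow> convex_fun (f i)"
  shows "convex_fun (\<lambda>x. SUP i\<in>I. f i x)"
  unfolding convex_fun_def
proof (intro allI ballI SUP_least)
  fix x y i and t :: real assume t: "t \<in> {0<..<1}" and i: "i \<in> I"
  have "f i ((1 - t) *\<^sub>R x + t *\<^sub>R y) \<le> ereal (1 - t) * f i x + ereal t * f i y"
    using assms[OF i] t unfolding convex_fun_def by blast
  also have "\<dots> \<le> ereal (1 - t) * (SUP i\<in>I. f i x) + ereal t * (SUP i\<in>I. f i y)"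
    using t i by (intro add_mono ereal_mult_left_mono SUP_upper) auto
  finally show "f i ((1 - t) *\<^sub>R x + t *\<^sub>R y)
      \<le> ereal (1 - t) * (SUP i\<in>I. f i x) + ereal t * (SUP i\<in>I. f i y)" .
qed

lemma proper_closed_convex_finite:
  assumes "f \<in> proper_closed_convex" "f x \<noteq> \<infinity>"
  shows "ereal (real_of_ereal (f x)) = f x"
  using assms unfolding proper_closed_convex_def proper_fun_def by (cases "f x") auto

lemma proper_closed_convex_combine:
  assumes f: "f \<in> proper_closed_convex" and x: "f x \<noteq> \<infinity>" and y: "f y \<noteq> \<infinity>" and t: "0 < t" "t < 1"
  shows "f (x + t *\<^sub>R (y - x)) \<noteq> \<infinity>"
    and "real_of_ereal (f (x + t *\<^sub>R (y - x)))
           \<le> (1 - t) * real_of_ereal (f x) + t * real_of_ereal (f y)"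
proof -
  have "x + t *\<^sub>R (y - x) = (1 - t) *\<^sub>R x + t *\<^sub>R y"
    by (simp add: algebra_simps)
  then have "f (x + t *\<^sub>R (y - x)) \<le> ereal (1 - t) * f x + ereal t * f y"
    using f t unfolding proper_closed_convex_def convex_fun_def by simp
  also have "\<dots> = ereal ((1 - t) * real_of_ereal (f x) + t * real_of_ereal (f y))"
    using proper_closed_convex_finite[OF f x] proper_closed_convex_finite[OF f y]
    by (metis plus_ereal.simps(1) times_ereal.simps(1))
  finally have le: "f (x + t *\<^sub>R (y - x))
      \<le> ereal ((1 - t) * real_of_ereal (f x) + t * real_of_ereal (f y))" .
  then show fin: "f (x + t *\<^sub>R (y - x)) \<noteq> \<infinity>" by auto
  show "real_of_ereal (f (x + t *\<^sub>R (y - x)))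
           \<le> (1 - t) * real_of_ereal (f x) + t * real_of_ereal (f y)"
    using le proper_closed_convex_finite[OF f fin] by (metis ereal_less_eq(3))
qed

text \<open>Lower semicontinuity keeps f above f(x0) - 1 on a ball of radius r around x0. Convexity
  along the segment from x0 to a distant x turns this into decay that is at most linear, with slope
  2/r. This makes the objective in \<open>prox_exists\<close> bounded below.\<close>

lemma proper_closed_convex_lower_bound:
  fixes f :: "'a::real_inner \<Rightarrow> ereal"
  assumes f: "f \<in> proper_closed_convex" and x0: "f x0 \<noteq> \<infinity>"
  obtains L where "L \<ge> 0"
    "\<And>x. f x \<noteq> \<infinity> \<Longrightarrow> real_of_ereal (f x) \<ge> real_of_ereal (f x0) - 1 - L * norm (x - x0)"
proof -
  let ?h = "\<lambda>x. real_of_ereal (f x)"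
  have "ereal (?h x0 - 1) < f x0"
    using proper_closed_convex_finite[OF f x0] by (metis ereal_less(2) less_ereal.simps(1) diff_less_eq less_add_one)
  then have "\<forall>\<^sub>F y in nhds x0. ereal (?h x0 - 1) < f y"
    using f unfolding proper_closed_convex_def lsc_fun_iff_eventually_nhds by blast
  then obtain r where r: "r > 0" "\<And>y. dist y x0 < r \<Longrightarrow> ereal (?h x0 - 1) < f y"
    unfolding eventually_nhds_metric by blast
  have near: "?h x0 - 1 < ?h y" if "dist y x0 < r" "f y \<noteq> \<infinity>" for y
    using r(2)[OF that(1)] proper_closed_convex_finite[OF f that(2)] by (metis less_ereal.simps(1))
  show thesis
  proof (rule that[of "2 / r"])
    fix x assume x: "f x \<noteq> \<infinity>"
    show "?h x \<ge> ?h x0 - 1 - 2 / r * norm (x - x0)"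
    proof (cases "dist x x0 < r")
      case True
      have "2 / r * norm (x - x0) \<ge> 0" using r by simp
      with near[OF True x] show ?thesis by linarith
    next
      case False
      define N where "N = norm (x - x0)"
      have N: "N \<ge> r" using False by (simp add: N_def dist_norm)
      \<comment> \<open>This puts x0 + t (x - x0) at distance r/2 from x0, inside the ball.\<close>
      define t where "t = r / (2 * N)"
      have t: "0 < t" "t < 1" using N r by (auto simp: t_def field_simps)
      have "dist (x0 + t *\<^sub>R (x - x0)) x0 = t * N" using t by (simp add: dist_norm N_def)
      also have "\<dots> < r" using N r by (simp add: t_def)
      finally have "?h x0 - 1 < ?h (x0 + t *\<^sub>R (x - x0))"
        using near proper_closed_convex_combine(1)[OF f x0 x t] by blast
      also have "\<dots> \<le> (1 - t) * ?h x0 + t * ?h x"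
        by (rule proper_closed_convex_combine(2)[OF f x0 x t])
      finally have "t * ?h x0 - 1 < t * ?h x" by (simp add: algebra_simps)
      then have "(t * ?h x0 - 1) / t < ?h x" using t by (simp add: field_simps)
      moreover have "(t * ?h x0 - 1) / t = ?h x0 - 2 / r * N"
        using t r N by (simp add: t_def field_simps)
      ultimately show ?thesis by (simp add: N_def)
    qed
  qed (use r in auto)
qed

text \<open>Direct method: x minimizes g = f + |. - z|^2 / 2, and its optimality condition is the
  claim. Completeness of the space enters here; Minty's theorem and the Riesz representation inherit
  it from this lemma.\<close>

lemma prox_exists:
  fixes f :: "'a::{real_inner, complete_space} \<Rightarrow> ereal"
  assumes f: "f \<in> proper_closed_convex"
  shows "\<exists>x. z - x \<in> subdiff f x"
proof -
  define h where "h = (\<lambda>x. real_of_ereal (f x))"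
  define D where "D = {x. f x \<noteq> \<infinity>}"
  define g where "g = (\<lambda>x. h x + (norm (x - z))\<^sup>2 / 2)"
  have fh: "f x = ereal (h x)" if "x \<in> D" for x
    using proper_closed_convex_finite[OF f] that unfolding h_def D_def by simp
  have comb: "x + t *\<^sub>R (y - x) \<in> D" "h (x + t *\<^sub>R (y - x)) \<le> (1 - t) * h x + t * h y"
    if "x \<in> D" "y \<in> D" "0 < t" "t < 1" for x y t
    using proper_closed_convex_combine[OF f, of x y t] that unfolding h_def D_def by auto
  obtain x0 where x0: "x0 \<in> D"
    using f unfolding proper_closed_convex_def proper_fun_def D_def by auto
  obtain L where L: "L \<ge> 0" "\<And>x. x \<in> D \<Longrightarrow> h x \<ge> h x0 - 1 - L * norm (x - x0)"
    using proper_closed_convex_lower_bound[OF f, of x0] x0 unfolding h_def D_def by auto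
  have lower: "g x \<ge> h x0 - 1 - L * norm (z - x0) - L\<^sup>2 / 2" if "x \<in> D" for x
  proof -
    have "norm (x - x0) \<le> norm (x - z) + norm (z - x0)"
      by (metis dist_norm dist_triangle)
    then have "L * norm (x - x0) \<le> L * norm (x - z) + L * norm (z - x0)"
      using L(1) by (metis distrib_left mult_left_mono)
    \<comment> \<open>Completing the square absorbs the linear decay of f into the quadratic
      term.\<close>
    moreover have "0 \<le> (norm (x - z) - L)\<^sup>2" by simp
    then have "L * norm (x - z) - L\<^sup>2 / 2 \<le> (norm (x - z))\<^sup>2 / 2 "
      by (simp add: power2_eq_square algebra_simps)
    ultimately show ?thesis using L(2)[OF that] by (simp add: g_def)
  qed
  define m where "m = Inf (g ` D)"
  have bdd: "bdd_below (g ` D)" using lower by (rule bdd_belowI2)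
  have m: "m \<le> g x" if "x \<in> D" for x
    unfolding m_def using bdd that by (rule cINF_lower)
  have "\<exists>x\<in>D. g x < m + 1 / real (Suc n)" for n
  proof -
    have "Inf (g ` D) < m + 1 / real (Suc n)" by (simp add: m_def)
    then show ?thesis using bdd x0 by (subst (asm) cInf_less_iff) auto
  qed
  then obtain X where X: "\<And>n. X n \<in> D" "\<And>n. g (X n) < m + 1 / real (Suc n)" by metis
  \<comment> \<open>The parallelogram law at the midpoint of x and y: two almost minimizers of g are
    close to each other, so a minimizing sequence is Cauchy.\<close>
  have mid: "(norm (x - y))\<^sup>2 \<le> 4 * (g x + g y - 2 * m)" if "x \<in> D" "y \<in> D" for x y
  proof -
    have "m \<le> g (x + (1/2) *\<^sub>R (y - x))" using comb(1)[OF that, of "1/2"] m by auto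
    also have "\<dots> \<le> h x / 2 + h y / 2 + (norm (x + (1/2) *\<^sub>R (y - x) - z))\<^sup>2 / 2"
      using comb(2)[OF that, of "1/2"] by (simp add: g_def)
    also have "x + (1/2) *\<^sub>R (y - x) - z = (1/2) *\<^sub>R ((x - z) + (y - z))"
      by (simp add: algebra_simps flip: scaleR_2)
    also have "(norm ((1/2) *\<^sub>R ((x - z) + (y - z))))\<^sup>2
        = ((norm (x - z))\<^sup>2 * 2 + (norm (y - z))\<^sup>2 * 2 - (norm (x - y))\<^sup>2) / 4"
      by (simp add: power2_norm_eq_inner algebra_simps inner_commute)
    finally show ?thesis by (simp add: g_def field_simps)
  qed
  have "Cauchy X"
  proof (rule metric_CauchyI)
    fix e :: real assume e: "e > 0"
    obtain N where N: "1 / real (Suc N) < e\<^sup>2 / 8"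
      using e by (metis nat_approx_posE zero_less_divide_iff zero_less_numeral zero_less_power)
    have "dist (X i) (X j) < e" if "i \<ge> N" "j \<ge> N" for i j
    proof -
      have *: "g (X k) < m + e\<^sup>2 / 8" if "k \<ge> N" for k
      proof -
        have "1 / real (Suc k) \<le> 1 / real (Suc N)" using that by (simp add: frac_le)
        then show ?thesis using X(2)[of k] N by linarith
      qed
      have "(norm (X i - X j))\<^sup>2 < e\<^sup>2"
        using mid[OF X(1) X(1), of i j] *[OF that(1)] *[OF that(2)] by (simp add: field_simps)
      then show ?thesis using e by (metis dist_norm less_eq_real_def power_less_imp_less_base)
    qed
    then show "\<exists>M. \<forall>m\<ge>M. \<forall>n\<ge>M. dist (X m) (X n) < e" by blast
  qed
  then obtain x where x: "X \<longlonglongrightarrow> x"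
    by (metis Cauchy_convergent_iff convergent_def)
  have gX: "(\<lambda>n. g (X n)) \<longlonglongrightarrow> m"
  proof (rule tendsto_sandwich[where f = "\<lambda>_. m" and h = "\<lambda>n. m + 1 / real (Suc n)"])
    show "(\<lambda>n. m + 1 / real (Suc n)) \<longlonglongrightarrow> m"
      using tendsto_add[OF tendsto_const LIMSEQ_Suc[OF lim_1_over_n], of m] by simp
  qed (use m X in \<open>auto intro!: always_eventually less_imp_le\<close>)
  have hX: "(\<lambda>n. h (X n)) \<longlonglongrightarrow> m - (norm (x - z))\<^sup>2 / 2"
  proof -
    have "(\<lambda>n. g (X n) - (norm (X n - z))\<^sup>2 / 2) \<longlonglongrightarrow> m - (norm (x - z))\<^sup>2 / 2"
      by (intro tendsto_intros gX x) auto
    then show ?thesis by (simp add: g_def)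
  qed
  have fx: "f x \<le> ereal (m - (norm (x - z))\<^sup>2 / 2)"
  proof (rule ccontr)
    assume "\<not> ?thesis"
    then obtain c where c: "ereal (m - (norm (x - z))\<^sup>2 / 2) < ereal c" "ereal c < f x"
      by (meson ereal_dense2 not_le)
    have "\<forall>\<^sub>F y in nhds x. ereal c < f y"
      using f c(2) unfolding proper_closed_convex_def lsc_fun_iff_eventually_nhds by blast
    then have "\<forall>\<^sub>F n in sequentially. ereal c < f (X n)"
      using x by (rule eventually_compose_filterlim)
    moreover have "\<forall>\<^sub>F n in sequentially. h (X n) < c"
      using hX c(1) by (auto intro: order_tendstoD)
    ultimately have "\<forall>\<^sub>F n in sequentially. False"
      by eventually_elim (use fh X in auto)
    then show False by simp
  qed
  then have xD: "x \<in> D" unfolding D_def by auto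
  then have gm: "g x \<le> m" using fx fh by (simp add: g_def)
  \<comment> \<open>Minimality of x is compared with the points x + t (y - x). After division by t
    the quadratic error is of order t and vanishes as t decreases to 0.\<close>
  have sub: "h x + inner (z - x) (y - x) \<le> h y" if y: "y \<in> D" for y
  proof -
    have "h x + inner (z - x) (y - x) \<le> h y + t * (norm (y - x))\<^sup>2 / 2" if t: "0 < t" "t < 1" for t
    proof -
      \<comment> \<open>Pure real arithmetic: p and q stand for h x and h y, i for the inner
        product, s and n for the squared norms of x - z and y - x.\<close>
      have aux: "t * (p + i) \<le> t * (q + t * n / 2)"
        if "p + s / 2 \<le> (1 - t) * p + t * q + (s - 2 * t * i + t * (t * n)) / 2" for p i q n s :: real
        using that by (simp add: field_simps)
      have "g x \<le> g (x + t *\<^sub>R (y - x))" using gm m comb(1)[OF xD y t] by force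
      then have "h x + (norm (x - z))\<^sup>2 / 2
          \<le> (1 - t) * h x + t * h y + (norm (x + t *\<^sub>R (y - x) - z))\<^sup>2 / 2"
        using comb(2)[OF xD y t] by (simp add: g_def)
      also have "x + t *\<^sub>R (y - x) - z = (x - z) + t *\<^sub>R (y - x)" by simp
      also have "(norm ((x - z) + t *\<^sub>R (y - x)))\<^sup>2
          = (norm (x - z))\<^sup>2 - 2 * t * inner (z - x) (y - x) + t * (t * (norm (y - x))\<^sup>2)"
        unfolding power2_norm_eq_inner
        by (simp add: inner_add_left inner_add_right inner_diff_left inner_diff_right inner_commute
            algebra_simps)
      finally have "t * (h x + inner (z - x) (y - x)) \<le> t * (h y + t * (norm (y - x))\<^sup>2 / 2)"
        by (rule aux)
      then show ?thesis using t by simp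
    qed
    then have "\<forall>\<^sub>F t in at_right 0. h x + inner (z - x) (y - x) \<le> h y + t * (norm (y - x))\<^sup>2 / 2"
      by (auto simp: eventually_at_right_field intro!: exI[of _ 1])
    moreover have "((\<lambda>t. h y + t * (norm (y - x))\<^sup>2 / 2) \<longlongrightarrow> h y + 0 * (norm (y - x))\<^sup>2 / 2) (at_right 0)"
      by (intro tendsto_intros) auto
    ultimately show ?thesis
      using tendsto_le[OF trivial_limit_at_right_real _ tendsto_const] by fastforce
  qed
  show ?thesis
  proof (intro exI[of _ x])
    have "f x + ereal (inner (z - x) (y - x)) \<le> f y" for y
    proof (cases "y \<in> D")
      case True
      show ?thesis using sub[OF True] by (simp add: fh[OF True] fh[OF xD])
    next
      case False
      then show ?thesis by (simp add: D_def)
    qed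
    then show "z - x \<in> subdiff f x" by (simp add: subdiff_def)
  qed
qed

subsection \<open>Maximally monotone operators\<close>

lemma monotone_opD:
  assumes "monotone_op A" "u \<in> A x" "v \<in> A y"
  shows "0 \<le> inner (u - v) (x - y)"
  using assms unfolding monotone_op_def by blast

text \<open>A pair that is monotonically related to the whole graph can be adjoined without losing
  monotonicity, so maximality under inclusion already places it in the graph.\<close>

lemma maximally_monotone_iff:
  "maximally_monotone A \<longleftrightarrow> monotone_op A \<and>
     (\<forall>x u. (\<forall>y. \<forall>v\<in>A y. 0 \<le> inner (u - v) (x - y)) \<longrightarrow> u \<in> A x)"
proof (intro iffI conjI allI impI)
  assume A: "maximally_monotone A"
  then show mono: "monotone_op A" by (simp add: maximally_monotone_def)
  fix x u assume rel: "\<forall>y. \<forall>v\<in>A y. 0 \<le> inner (u - v) (x - y)"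
  let ?B = "A(x := insert u (A x))"
  have swap: "inner (a - b) (c - d) = inner (b - a) (d - c)" for a b c d :: 'a
    by (simp add: inner_diff_left inner_diff_right)
  have "monotone_op ?B"
    using mono rel swap unfolding monotone_op_def
    by (auto split: if_splits)
  moreover have "A \<le> ?B" by (auto simp: le_fun_def)
  ultimately have "?B = A" using A by (simp add: maximally_monotone_def)
  then show "u \<in> A x" by (metis fun_upd_same insertI1)
next
  assume A: "monotone_op A \<and> (\<forall>x u. (\<forall>y. \<forall>v\<in>A y. 0 \<le> inner (u - v) (x - y)) \<longrightarrow> u \<in> A x)"
  show "maximally_monotone A"
    unfolding maximally_monotone_def
  proof (intro conjI allI impI)
    show "monotone_op A" using A by simp
    fix B assume B: "monotone_op B \<and> A \<le> B"
    then have "B x \<subseteq> A x" for x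
      using A monotone_opD[of B] unfolding le_fun_def by (meson subset_iff)
    then show "B = A" using B by (intro antisym) (auto simp: le_fun_def)
  qed
qed

text \<open>The easy half of Minty's theorem. For a pair (x, u) related to the graph, surjectivity
  of Id + A gives y with x + u - y in A y, and the relation at y reads -|x - y|^2 \<ge> 0.\<close>

lemma maximally_monotoneI:
  assumes mono: "monotone_op A" and surj: "\<And>z. \<exists>x. z - x \<in> A x"
  shows "maximally_monotone A"
  unfolding maximally_monotone_iff
proof (intro conjI allI impI mono)
  fix x u assume rel: "\<forall>y. \<forall>v\<in>A y. 0 \<le> inner (u - v) (x - y)"
  obtain y where y: "x + u - y \<in> A y" using surj by blast
  with rel have "0 \<le> inner (u - (x + u - y)) (x - y)" by blast
  then have "inner (x - y) (x - y) \<le> 0" by (simp add: inner_diff_left inner_diff_right inner_commute)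
  then have "x = y" by (metis eq_iff_diff_eq_0 inner_eq_zero_iff inner_ge_zero order_antisym)
  then show "u \<in> A x" using y by simp
qed

lemma subdiff_finite:
  assumes "f \<in> proper_closed_convex" "u \<in> subdiff f x"
  shows "f x \<noteq> \<infinity>"
proof
  assume "f x = \<infinity>"
  with assms(2) have "f y = \<infinity>" for y by (auto simp: subdiff_def split: if_splits)
  then show False using assms(1) by (simp add: proper_closed_convex_def proper_fun_def)
qed

lemma subdiff_ineq:
  assumes f: "f \<in> proper_closed_convex" and u: "u \<in> subdiff f x" and v: "v \<in> subdiff f y"
  shows "real_of_ereal (f x) + inner u (y - x) \<le> real_of_ereal (f y)"
proof -
  have "f x + ereal (inner u (y - x)) \<le> f y" using u by (simp add: subdiff_def)
  then show ?thesis
    using proper_closed_convex_finite[OF f subdiff_finite[OF f u]]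
      proper_closed_convex_finite[OF f subdiff_finite[OF f v]]
    by (metis ereal_less_eq(3) plus_ereal.simps(1))
qed

lemma subdiff_monotone:
  assumes f: "f \<in> proper_closed_convex"
  shows "monotone_op (subdiff f)"
  unfolding monotone_op_def
proof (intro allI ballI)
  fix x y u v assume uv: "u \<in> subdiff f x" "v \<in> subdiff f y"
  show "0 \<le> inner (u - v) (x - y)"
    using subdiff_ineq[OF f uv] subdiff_ineq[OF f uv(2,1)]
    by (simp add: inner_diff_left inner_diff_right)
qed

text \<open>Solvability of the proximal problem is surjectivity of Id +
  \<open>subdiff f\<close>.\<close>

lemma subdiff_ops_subset_maxmono_ops:
  "(subdiff_ops :: 'a::{real_inner, complete_space} setop set) \<subseteq> maxmono_ops"
  unfolding subdiff_ops_def maxmono_ops_def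
  using maximally_monotoneI[OF subdiff_monotone prox_exists] by blast

section \<open>Fitzpatrick functions and Minty's theorem\<close>

text \<open>The value at (x, u) equals <x, u> minus the infimum of <x - y, u - v> over (y, v) in G,
  so it measures how far (x, u) is from being monotonically related to G. Being a supremum of
  continuous affine functions, it brings monotone graphs within reach of
  \<open>prox_exists\<close>.\<close>

definition fitzpatrick :: "('a::real_inner \<times> 'a) set \<Rightarrow> 'a \<times> 'a \<Rightarrow> ereal" where
  "fitzpatrick G p = (SUP (y, v)\<in>G. ereal (inner y (snd p) + inner (fst p) v - inner y v))"

lemma fitzpatrick_on_graph:
  assumes "\<And>x u y v. (x, u) \<in> G \<Longrightarrow> (y, v) \<in> G \<Longrightarrow> 0 \<le> inner (x - y) (u - v)" "(x, u) \<in> G"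
  shows "fitzpatrick G (x, u) = ereal (inner x u)"
  unfolding fitzpatrick_def
proof (rule antisym)
  show "(SUP (y, v)\<in>G. ereal (inner y (snd (x, u)) + inner (fst (x, u)) v - inner y v)) \<le> ereal (inner x u)"
  proof (rule SUP_least, clarify)
    fix y v assume "(y, v) \<in> G"
    from assms(1)[OF assms(2) this]
    show "ereal (inner y (snd (x, u)) + inner (fst (x, u)) v - inner y v) \<le> ereal (inner x u)"
      by (simp add: inner_diff_left inner_diff_right)
  qed
  show "ereal (inner x u) \<le> (SUP (y, v)\<in>G. ereal (inner y (snd (x, u)) + inner (fst (x, u)) v - inner y v))"
    by (rule SUP_upper2[OF assms(2)]) simp
qed

text \<open>Off the graph, maximality provides (y, v) with <x - y, u - v> < 0, and the term of this
  pair in the supremum exceeds <x, u>.\<close>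

lemma fitzpatrick_ge:
  assumes max: "\<And>x u. (\<And>y v. (y, v) \<in> G \<Longrightarrow> 0 \<le> inner (x - y) (u - v)) \<Longrightarrow> (x, u) \<in> G"
  shows "ereal (inner x u) \<le> fitzpatrick G (x, u)"
proof (cases "(x, u) \<in> G")
  case True
  then show ?thesis unfolding fitzpatrick_def by (rule SUP_upper2) simp
next
  case False
  then obtain y v where yv: "(y, v) \<in> G" "inner (x - y) (u - v) < 0"
    using max[of x u] by (meson not_le)
  then show ?thesis unfolding fitzpatrick_def
    by (intro SUP_upper2[OF yv(1)]) (auto simp: inner_diff_left inner_diff_right)
qed

lemma fitzpatrick_proper_closed_convex:
  assumes "G \<noteq> {}" "\<And>x u y v. (x, u) \<in> G \<Longrightarrow> (y, v) \<in> G \<Longrightarrow> 0 \<le> inner (x - y) (u - v)"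
  shows "fitzpatrick G \<in> proper_closed_convex"
proof -
  obtain x u where xu: "(x, u) \<in> G" using assms(1) by auto
  have "fitzpatrick G p \<noteq> -\<infinity>" for p
  proof -
    have "ereal (inner x (snd p) + inner (fst p) u - inner x u) \<le> fitzpatrick G p"
      unfolding fitzpatrick_def by (rule SUP_upper2[OF xu]) simp
    then show ?thesis by auto
  qed
  moreover have "fitzpatrick G (x, u) \<noteq> \<infinity>"
    using fitzpatrick_on_graph[OF assms(2) xu] by simp
  ultimately have "proper_fun (fitzpatrick G)" unfolding proper_fun_def by blast
  moreover have "lsc_fun (fitzpatrick G)"
    unfolding fitzpatrick_def
    by (rule lsc_fun_SUP) (auto intro!: lsc_fun_continuous continuous_intros)
  moreover have "convex_fun (fitzpatrick G)"
    unfolding fitzpatrick_def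
    by (rule convex_fun_SUP) (auto simp: convex_fun_def inner_add_left inner_add_right algebra_simps)
  ultimately show ?thesis by (simp add: proper_closed_convex_def)
qed

text \<open>Evaluating the subgradient inequality of the prox point \<open>(x, u)\<close> of the Fitzpatrick function on
  the graph shows that \<open>(-u, -x)\<close> is monotonically related to the graph, so it lies on it; the same
  inequality at this point forces \<open>x + u = 0\<close>.\<close>

lemma minty_graph:
  fixes G :: "('a::{real_inner, complete_space} \<times> 'a) set"
  assumes mono: "\<And>x u y v. (x, u) \<in> G \<Longrightarrow> (y, v) \<in> G \<Longrightarrow> 0 \<le> inner (x - y) (u - v)"
    and max: "\<And>x u. (\<And>y v. (y, v) \<in> G \<Longrightarrow> 0 \<le> inner (x - y) (u - v)) \<Longrightarrow> (x, u) \<in> G"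
  shows "\<exists>x. (x, - x) \<in> G"
proof -
  have ne: "G \<noteq> {}" using max by blast
  note F = fitzpatrick_proper_closed_convex[OF ne mono]
  obtain x u where "(0, 0) - (x, u) \<in> subdiff (fitzpatrick G) (x, u)"
    using prox_exists[OF F] by (metis surj_pair)
  then have sub: "fitzpatrick G (x, u) + ereal (inner (- x) (y - x) + inner (- u) (v - u))
      \<le> fitzpatrick G (y, v)" for y v
    by (auto simp: subdiff_def)
  have key: "(norm (x + u))\<^sup>2 \<le> inner (y + u) (v + x)" if "(y, v) \<in> G" for y v
  proof -
    have "ereal (inner x u) + ereal (inner (- x) (y - x) + inner (- u) (v - u)) \<le> ereal (inner y v)"
      using add_right_mono[OF fitzpatrick_ge[OF max]] sub fitzpatrick_on_graph[OF mono that]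
      by (metis order_trans)
    then show ?thesis
      by (simp add: power2_norm_eq_inner inner_add_left inner_add_right inner_diff_left
          inner_diff_right inner_commute)
  qed
  have G: "(- u, - x) \<in> G"
  proof (rule max)
    fix y v assume "(y, v) \<in> G"
    from order_trans[OF zero_le_power2 key[OF this]]
    show "0 \<le> inner (- u - y) (- x - v)"
      by (simp add: inner_add_left inner_add_right inner_diff_left inner_diff_right)
  qed
  from key[OF this] have "x = - u" by (simp add: add_eq_0_iff2)
  with G show ?thesis by (intro exI[of _ "- u"]) simp
qed

text \<open>\<open>minty_graph\<close> is applied to the graph of \<alpha> A - z, which is again
  maximally monotone: a pair (x, -x) on it is a solution of z = x + \<alpha> u with u in A
  x.\<close>

theorem minty:
  fixes A :: "'a::{real_inner, complete_space} setop"
  assumes A: "maximally_monotone A" and \<alpha>: "\<alpha> > 0"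
  obtains x u where "u \<in> A x" "z = x + \<alpha> *\<^sub>R u"
proof -
  let ?G = "{(x, \<alpha> *\<^sub>R u - z) | x u. u \<in> A x}"
  have "\<exists>x. (x, - x) \<in> ?G"
  proof (rule minty_graph)
    fix x u y v assume "(x, u) \<in> ?G" "(y, v) \<in> ?G"
    then obtain u' v' where *: "u' \<in> A x" "v' \<in> A y" "u = \<alpha> *\<^sub>R u' - z" "v = \<alpha> *\<^sub>R v' - z" by auto
    then have "0 \<le> \<alpha> * inner (u' - v') (x - y)"
      using A \<alpha> by (intro mult_nonneg_nonneg monotone_opD) (auto simp: maximally_monotone_def)
    then show "0 \<le> inner (x - y) (u - v)"
      using * by (simp add: inner_commute flip: scaleR_diff_right)
  next
    fix x u assume rel: "\<And>y v. (y, v) \<in> ?G \<Longrightarrow> 0 \<le> inner (x - y) (u - v)"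
    have "(1 / \<alpha>) *\<^sub>R (u + z) \<in> A x"
    proof -
      have "0 \<le> inner ((1 / \<alpha>) *\<^sub>R (u + z) - v) (x - y)" if "v \<in> A y" for y v
      proof -
        have "0 \<le> (1 / \<alpha>) * inner (x - y) (u - (\<alpha> *\<^sub>R v - z))"
          using rel[of y "\<alpha> *\<^sub>R v - z"] that \<alpha> by (intro mult_nonneg_nonneg) auto
        also have "\<dots> = inner (x - y) ((1 / \<alpha>) *\<^sub>R (u - (\<alpha> *\<^sub>R v - z)))" by simp
        also have "(1 / \<alpha>) *\<^sub>R (u - (\<alpha> *\<^sub>R v - z)) = (1 / \<alpha>) *\<^sub>R (u + z) - v"
          using \<alpha> by (simp add: algebra_simps)
        finally show ?thesis by (simp add: inner_commute)
      qed
      then show ?thesis using A unfolding maximally_monotone_iff by blast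
    qed
    moreover have "u = \<alpha> *\<^sub>R ((1 / \<alpha>) *\<^sub>R (u + z)) - z" using \<alpha> by simp
    ultimately show "(x, u) \<in> ?G" by blast
  qed
  then obtain x u where "u \<in> A x" "- x = \<alpha> *\<^sub>R u - z" by auto
  then show thesis using that[of u x] by (simp add: algebra_simps)
qed

section \<open>Resolvents as graph elements\<close>

text \<open>If y with v in A y solves the same equation, then \<alpha> (u - v) = -(x - y), and
  monotonicity gives |x - y|^2 \<le> 0. So the description in \<open>resolvent\<close> is
  unambiguous.\<close>

lemma resolvent_eqI:
  assumes A: "monotone_op A" and \<alpha>: "\<alpha> > 0" and u: "u \<in> A x" and z: "z = x + \<alpha> *\<^sub>R u"
  shows "resolvent \<alpha> A z = x"
  unfolding resolvent_def
proof (rule the_equality)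
  fix y assume "z \<in> {y + \<alpha> *\<^sub>R v |v. v \<in> A y}"
  then obtain v where v: "v \<in> A y" "z = y + \<alpha> *\<^sub>R v" by auto
  have "0 \<le> \<alpha> * inner (u - v) (x - y)" using monotone_opD[OF A u v(1)] \<alpha> by simp
  also have "\<dots> = inner (\<alpha> *\<^sub>R u - \<alpha> *\<^sub>R v) (x - y)" by (simp flip: scaleR_diff_right)
  also have "\<alpha> *\<^sub>R u - \<alpha> *\<^sub>R v = - (x - y)" using z v(2) by (simp add: algebra_simps)
  finally have "inner (x - y) (x - y) \<le> 0" by (simp only: inner_minus_left neg_0_le_iff_le)
  then show "y = x" by (metis eq_iff_diff_eq_0 inner_eq_zero_iff inner_ge_zero order_antisym)
qed (use u z in blast)

text \<open>Turns every resolvent evaluation of the algorithm into a point of the graph, which is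
  how the iteration is analysed.\<close>

lemma resolvent_residual:
  fixes A :: "'a::{real_inner, complete_space} setop"
  assumes A: "maximally_monotone A" and \<alpha>: "\<alpha> > 0"
  shows "(1 / \<alpha>) *\<^sub>R (z - resolvent \<alpha> A z) \<in> A (resolvent \<alpha> A z)"
proof -
  obtain x u where xu: "u \<in> A x" "z = x + \<alpha> *\<^sub>R u" using minty[OF A \<alpha>] .
  have "resolvent \<alpha> A z = x"
    using resolvent_eqI[OF _ \<alpha>, of A u x z] xu A by (simp add: maximally_monotone_def)
  then show ?thesis using xu \<alpha> by simp
qed

subsection \<open>Weak cluster points\<close>

text \<open>The representing vector w minimizes |w|^2 / 2 - \<phi>(w), the proximal problem of
  -\<phi> at 0. Optimality gives \<phi> \<le> <w, .>, and replacing y by -y gives equality.\<close>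

lemma riesz_representation:
  fixes \<phi> :: "'a::{real_inner, complete_space} \<Rightarrow> real"
  assumes "bounded_linear \<phi>"
  obtains w where "\<And>y. \<phi> y = inner w y"
proof -
  interpret bounded_linear \<phi> by fact
  have "continuous_on UNIV (\<lambda>x. - \<phi> x)"
    by (intro continuous_on_minus continuous_on continuous_on_id)
  then have "(\<lambda>x. ereal (- \<phi> x)) \<in> proper_closed_convex"
    unfolding proper_closed_convex_def proper_fun_def convex_fun_def
    by (auto intro!: lsc_fun_continuous simp: add scaleR)
  from prox_exists[OF this, of 0]
  obtain w where "0 - w \<in> subdiff (\<lambda>x. ereal (- \<phi> x)) w" ..
  then have le: "\<phi> (y - w) \<le> inner w (y - w)" for y
    by (simp add: subdiff_def diff) (smt (verit))
  have le': "\<phi> y \<le> inner w y" for y using le[of "w + y"] by simp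
  have "\<phi> y = inner w y" for y
    using le'[of y] le'[of "- y"] by (simp add: linear_neg[OF linear_axioms])
  then show thesis using that by blast
qed

definition weakly_tendsto :: "('i \<Rightarrow> 'a::real_inner) \<Rightarrow> 'a \<Rightarrow> 'i filter \<Rightarrow> bool" where
  "weakly_tendsto X l F \<longleftrightarrow> (\<forall>y. ((\<lambda>k. inner (X k) y) \<longlongrightarrow> inner l y) F)"

text \<open>Refinements of filters play the role of subsequences, so that Tychonoff's theorem in the space
  of all functions replaces the diagonal argument.\<close>

lemma bounded_weak_cluster_point:
  fixes X :: "'i \<Rightarrow> 'a::{real_inner, complete_space}"
  assumes bdd: "bounded (range X)" and G: "G \<noteq> bot"
  obtains F l where "F \<le> G" "F \<noteq> bot" "weakly_tendsto X l F"
proof -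
  obtain C where C: "\<And>k. norm (X k) \<le> C" using bdd by (auto simp: bounded_iff)
  \<comment> \<open>Each point becomes a functional on the space; all of these lie in the product
    \<open>K\<close> of compact intervals, whose cluster points are pointwise limits.\<close>
  define T where "T = (\<lambda>k y. inner (X k) y)"
  define K where "K = (PiE UNIV (\<lambda>y::'a. {- (C * norm y)..C * norm y}) :: ('a \<Rightarrow> real) set)"
  have "compactin (product_topology (\<lambda>i. euclidean) UNIV) K"
    unfolding K_def compactin_PiE by auto
  then have "compact K" by (simp add: euclidean_product_topology)
  moreover have "\<forall>\<^sub>F \<psi> in filtermap T G. \<psi> \<in> K"
  proof -
    have "\<bar>inner (X k) y\<bar> \<le> C * norm y" for k y
      by (rule order_trans[OF Cauchy_Schwarz_ineq2 mult_right_mono[OF C]]) simp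
    then show ?thesis
      by (auto simp: eventually_filtermap K_def T_def abs_le_iff minus_le_iff intro!: always_eventually)
  qed
  moreover have "filtermap T G \<noteq> bot" using G by (simp add: filtermap_bot_iff)
  ultimately obtain \<phi> where \<phi>: "\<phi> \<in> K" "inf (nhds \<phi>) (filtermap T G) \<noteq> bot"
    unfolding compact_filter by blast
  define F where "F = inf (filtercomap T (nhds \<phi>)) G"
  have FG: "F \<le> G" by (simp add: F_def)
  \<comment> \<open>If \<open>F\<close> were trivial, some neighbourhood of \<phi> would miss all
    \<open>T k\<close> with k in a set belonging to \<open>G\<close>, and \<phi> would not be a
    cluster point of \<open>filtermap T G\<close>.\<close>
  have Fne: "F \<noteq> bot"
  proof
    assume "F = bot"
    then have "eventually (\<lambda>_. False) (inf (filtercomap T (nhds \<phi>)) G)" by (simp add: F_def)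
    then obtain P Q where PQ: "eventually P (filtercomap T (nhds \<phi>))" "eventually Q G"
      "\<And>k. P k \<Longrightarrow> Q k \<Longrightarrow> False"
      unfolding eventually_inf by blast
    then obtain P' where P': "eventually P' (nhds \<phi>)" "\<And>k. P' (T k) \<Longrightarrow> P k"
      unfolding eventually_filtercomap by blast
    have "eventually (\<lambda>\<psi>. \<exists>k. Q k \<and> \<psi> = T k) (filtermap T G)"
      unfolding eventually_filtermap using PQ(2) by eventually_elim blast
    with P'(1) have "eventually (\<lambda>_. False) (inf (nhds \<phi>) (filtermap T G))"
      unfolding eventually_inf using P'(2) PQ(3) by blast
    then show False using \<phi>(2) by simp
  qed
  have "filterlim T (nhds \<phi>) F"
    unfolding F_def by (rule filterlim_mono[OF filterlim_filtercomap order_refl inf_le1])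
  then have lim: "((\<lambda>k. inner (X k) y) \<longlongrightarrow> \<phi> y) F" for y
    using continuous_on_tendsto_compose[OF continuous_on_product_coordinates, of T \<phi> F y]
    by (simp add: T_def)
  \<comment> \<open>Linearity passes to the pointwise limit by uniqueness of limits; the bound is
    membership in \<open>K\<close>.\<close>
  have "bounded_linear \<phi>"
  proof (rule bounded_linear_intro[of _ C])
    fix x y :: 'a and r :: real
    show "\<phi> (x + y) = \<phi> x + \<phi> y"
      using tendsto_unique[OF Fne lim[of "x + y"]] tendsto_add[OF lim[of x] lim[of y]]
      by (simp add: inner_add_right)
    show "\<phi> (r *\<^sub>R x) = r *\<^sub>R \<phi> x"
      using tendsto_unique[OF Fne lim[of "r *\<^sub>R x"]] tendsto_mult[OF tendsto_const lim[of x], of r]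
      by simp
    show "norm (\<phi> x) \<le> norm x * C"
      using \<phi>(1) by (auto simp: K_def PiE_iff abs_le_iff mult.commute minus_le_iff)
  qed
  then obtain l where "\<And>y. \<phi> y = inner l y" by (rule riesz_representation) blast
  with lim have "weakly_tendsto X l F" by (simp add: weakly_tendsto_def)
  with FG Fne show thesis by (rule that)
qed

text \<open>If convergence failed for a test vector y, the indices with error at least e would
  define a nontrivial filter \<open>G\<close> below \<open>sequentially\<close>. By boundedness it
  has a weak cluster point, which must be l, contradicting the error.\<close>

lemma weakly_convergesI_unique_cluster:
  fixes X :: "nat \<Rightarrow> 'a::{real_inner, complete_space}"
  assumes bdd: "bounded (range X)"
    and unique: "\<And>F F' l l'. F \<le> sequentially \<Longrightarrow> F \<noteq> bot \<Longrightarrow> weakly_tendsto X l F \<Longrightarrow>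
      F' \<le> sequentially \<Longrightarrow> F' \<noteq> bot \<Longrightarrow> weakly_tendsto X l' F' \<Longrightarrow> l = l'"
  obtains l F where "F \<le> sequentially" "F \<noteq> bot" "weakly_tendsto X l F" "weakly_converges X l"
proof -
  obtain F l where F: "F \<le> sequentially" "F \<noteq> bot" "weakly_tendsto X l F"
    using bounded_weak_cluster_point[OF bdd sequentially_bot] .
  have "weakly_converges X l"
  proof (rule ccontr)
    assume "\<not> weakly_converges X l"
    then obtain y where "\<not> (\<lambda>k. inner (X k) y) \<longlonglongrightarrow> inner l y"
      unfolding weakly_converges_def by blast
    then obtain e where e: "e > 0" "\<not> (\<forall>\<^sub>F k in sequentially. dist (inner (X k) y) (inner l y) < e)"
      unfolding tendsto_iff by blast
    define G where "G = inf sequentially (principal {k. \<not> dist (inner (X k) y) (inner l y) < e})"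
    have "G \<noteq> bot"
      using e(2) by (auto simp: G_def eventually_inf_principal trivial_limit_def)
    then obtain F' l' where F': "F' \<le> G" "F' \<noteq> bot" "weakly_tendsto X l' F'"
      using bounded_weak_cluster_point[OF bdd] by metis
    have "F' \<le> sequentially" using F'(1) by (simp add: G_def)
    then have "l = l'" using unique[OF F _ F'(2,3)] by blast
    then have "\<forall>\<^sub>F k in F'. dist (inner (X k) y) (inner l y) < e"
      using F'(3) e(1) unfolding weakly_tendsto_def tendsto_iff by blast
    moreover have "\<forall>\<^sub>F k in F'. \<not> dist (inner (X k) y) (inner l y) < e"
      by (rule filter_leD[OF F'(1)]) (simp add: G_def eventually_inf_principal)
    ultimately have "\<forall>\<^sub>F k in F'. False" by eventually_elim simp
    then show False using F'(2) by simp
  qed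
  with F show thesis by (rule that)
qed

subsection \<open>Convergence\<close>

text \<open>All quantities are relative to a solution: x and y are the two iterates minus its primal
  point, a and b the graph elements minus its dual parts, p the Bregman distance, and primes mark
  the next iteration. The two hypotheses on p are its subgradient inequalities between consecutive
  iterates.\<close>

lemma lyapunov_decrease:
  fixes x a y b x' a' :: "'a::real_inner"
  assumes \<alpha>: "\<alpha> > 0" and \<beta>: "\<beta> > 0" and \<theta>: "\<theta> \<ge> 0"
    and xy: "x - y = \<beta> *\<^sub>R (a + b)"
    and pos: "0 \<le> inner a x + inner b y"
    and step: "x' + \<alpha> *\<^sub>R a' = x + \<alpha> *\<^sub>R a - \<theta> *\<^sub>R (x - y)"
    and p: "p + inner a (x' - x) \<le> p'" "p' + inner a' (x - x') \<le> p"
  shows "(norm (x' + \<alpha> *\<^sub>R a'))\<^sup>2 + 2 * (\<beta> - \<alpha>) * p' + \<alpha> * (\<beta> - \<alpha>) * (norm a')\<^sup>2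
    \<le> (norm (x + \<alpha> *\<^sub>R a))\<^sup>2 + 2 * (\<beta> - \<alpha>) * p + \<alpha> * (\<beta> - \<alpha>) * (norm a)\<^sup>2
      - \<theta> * (2 - \<theta> * max 1 (\<beta> / \<alpha>)) * (norm (x - y))\<^sup>2"
proof -
  define d e c where dec: "d = x - y" "e = x - x'" "c = a - a'"
  have \<theta>d: "\<theta> *\<^sub>R d = e + \<alpha> *\<^sub>R c"
    using step by (simp add: dec algebra_simps)
  have N': "(norm (x' + \<alpha> *\<^sub>R a'))\<^sup>2
      = (norm (x + \<alpha> *\<^sub>R a))\<^sup>2 - 2 * \<theta> * (inner x d + \<alpha> * inner a d) + \<theta>\<^sup>2 * (norm d)\<^sup>2"
    unfolding step dec(1)[symmetric] power2_norm_eq_inner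
    by (simp add: inner_add_left inner_add_right inner_diff_left inner_diff_right inner_commute
        algebra_simps power2_eq_square)
  have a': "(norm a')\<^sup>2 = (norm a)\<^sup>2 - 2 * inner a c + (norm c)\<^sup>2"
    unfolding dec power2_norm_eq_inner by (simp add: inner_diff_left inner_diff_right inner_commute)
  \<comment> \<open>Eliminating b and y by \<beta> b = d - \<beta> a and y = x - d turns
    \<open>pos\<close> into a lower bound for <x, d> + \<beta> <a, d>.\<close>
  have "inner x d + \<beta> * inner a d - (norm d)\<^sup>2 = \<beta> * (inner a x + inner b y)"
  proof -
    have "\<beta> * inner b y = inner (\<beta> *\<^sub>R (a + b) - \<beta> *\<^sub>R a) y" by (simp add: algebra_simps)
    also have "\<dots> = inner (d - \<beta> *\<^sub>R a) (x - d)" by (simp add: dec flip: xy)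
    finally show ?thesis
      by (simp add: power2_norm_eq_inner inner_diff_left inner_diff_right inner_commute algebra_simps)
  qed
  then have "0 \<le> \<theta> * (inner x d + \<beta> * inner a d - (norm d)\<^sup>2)"
    using pos \<beta> \<theta> by simp
  \<comment> \<open>The expanded square contains \<alpha> <a, d>, the monotonicity bound \<beta> <a,
    d>. The discrepancy is split along \<open>\<theta>d\<close> into changes of x and of a, to be
    balanced by the Bregman term and the term in |a|^2.\<close>
  moreover have ad: "\<theta> * inner a d = inner a e + \<alpha> * inner a c"
    using arg_cong[OF \<theta>d, of "inner a"] by (simp add: inner_add_right)
  have "(\<beta> - \<alpha>) * (\<theta> * inner a d) = (\<beta> - \<alpha>) * (inner a e + \<alpha> * inner a c)" by (simp only: ad)
  ultimately have general: "(norm (x' + \<alpha> *\<^sub>R a'))\<^sup>2 + 2 * (\<beta> - \<alpha>) * p' + \<alpha> * (\<beta> - \<alpha>) * (norm a')\<^sup>2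
    \<le> (norm (x + \<alpha> *\<^sub>R a))\<^sup>2 + 2 * (\<beta> - \<alpha>) * p + \<alpha> * (\<beta> - \<alpha>) * (norm a)\<^sup>2
      - \<theta> * (2 - \<theta>) * (norm d)\<^sup>2
      + (\<beta> - \<alpha>) * (2 * (inner a e - (p - p')) + \<alpha> * (norm c)\<^sup>2)"
    unfolding N' a' by (simp add: algebra_simps power2_eq_square)
  have p1: "p - p' \<le> inner a e" and p2: "inner a e - (p - p') \<le> inner c e"
    using p by (simp_all add: dec inner_diff_left inner_diff_right inner_commute)
  \<comment> \<open>For \<beta> \<le> \<alpha> the second factor is nonnegative by
    \<open>p1\<close>, so the product is at most 0. For \<beta> > \<alpha>, \<open>p2\<close> and |e
    + \<alpha> c|^2 = \<theta>^2 |d|^2 bound that factor by \<theta>^2 |d|^2 / \<alpha>, which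
    accounts for the maximum with \<beta>/\<alpha>.\<close>
  have "(\<beta> - \<alpha>) * (2 * (inner a e - (p - p')) + \<alpha> * (norm c)\<^sup>2)
      \<le> \<theta> * \<theta> * (max 1 (\<beta> / \<alpha>) - 1) * (norm d)\<^sup>2"
  proof (cases "\<beta> \<le> \<alpha>")
    case True
    then have "(\<beta> - \<alpha>) * (2 * (inner a e - (p - p')) + \<alpha> * (norm c)\<^sup>2) \<le> 0"
      using p1 \<alpha> by (intro mult_nonpos_nonneg) auto
    moreover have "max 1 (\<beta> / \<alpha>) = 1" using True \<alpha> by simp
    ultimately show ?thesis by simp
  next
    case False
    have "\<theta>\<^sup>2 * (norm d)\<^sup>2 = (norm (\<theta> *\<^sub>R d))\<^sup>2" by (simp add: power_mult_distrib)
    also have "\<dots> = (norm e)\<^sup>2 + \<alpha> * (2 * inner c e + \<alpha> * (norm c)\<^sup>2)"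
      unfolding \<theta>d power2_norm_eq_inner
      by (simp add: inner_add_left inner_add_right inner_commute algebra_simps)
    finally have "\<alpha> * (2 * inner c e + \<alpha> * (norm c)\<^sup>2) \<le> \<theta>\<^sup>2 * (norm d)\<^sup>2" by simp
    then have "2 * inner c e + \<alpha> * (norm c)\<^sup>2 \<le> \<theta>\<^sup>2 * (norm d)\<^sup>2 / \<alpha>"
      using \<alpha> by (simp add: pos_le_divide_eq mult.commute)
    then have "2 * (inner a e - (p - p')) + \<alpha> * (norm c)\<^sup>2 \<le> \<theta>\<^sup>2 * (norm d)\<^sup>2 / \<alpha>"
      by (rule order_trans[rotated]) (use p2 in simp)
    then have "(\<beta> - \<alpha>) * (2 * (inner a e - (p - p')) + \<alpha> * (norm c)\<^sup>2)
        \<le> (\<beta> - \<alpha>) * (\<theta>\<^sup>2 * (norm d)\<^sup>2 / \<alpha>)"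
      using False by (intro mult_left_mono) auto
    also have "\<dots> = \<theta> * \<theta> * (max 1 (\<beta> / \<alpha>) - 1) * (norm d)\<^sup>2"
      using False \<alpha> by (simp add: max_def field_simps power2_eq_square)
    finally show ?thesis .
  qed
  with general show ?thesis unfolding dec(1)[symmetric] by (simp add: algebra_simps)
qed

text \<open>Expanding the square, the right side exceeds the left by 2 (\<alpha> <a, x> + (\<beta> -
  \<alpha>) p). For \<beta> \<le> \<alpha> the bracket is at least \<beta> <a, x> because p \<le>
  <a, x>; otherwise both summands are nonnegative.\<close>

lemma lyapunov_coercive:
  fixes x a :: "'a::real_inner"
  assumes \<alpha>: "\<alpha> > 0" and \<beta>: "\<beta> > 0" and p: "0 \<le> p" "p \<le> inner a x"
  shows "(norm x)\<^sup>2 + \<alpha> * \<beta> * (norm a)\<^sup>2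
    \<le> (norm (x + \<alpha> *\<^sub>R a))\<^sup>2 + 2 * (\<beta> - \<alpha>) * p + \<alpha> * (\<beta> - \<alpha>) * (norm a)\<^sup>2"
proof -
  have "0 \<le> \<alpha> * inner a x + (\<beta> - \<alpha>) * p"
  proof (cases "\<beta> \<le> \<alpha>")
    case True
    then have "(\<beta> - \<alpha>) * inner a x \<le> (\<beta> - \<alpha>) * p" using p by (intro mult_left_mono_neg) auto
    moreover have "0 \<le> \<beta> * inner a x" using p \<beta> by simp
    ultimately show ?thesis by (simp add: algebra_simps)
  qed (use p \<alpha> in auto)
  moreover have "(norm (x + \<alpha> *\<^sub>R a))\<^sup>2 = (norm x)\<^sup>2 + 2 * \<alpha> * inner a x + \<alpha> * \<alpha> * (norm a)\<^sup>2"
    unfolding power2_norm_eq_inner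
    by (simp add: inner_add_left inner_add_right inner_commute algebra_simps)
  ultimately show ?thesis by (simp add: algebra_simps)
qed

lemma descent_sequence:
  fixes V w :: "nat \<Rightarrow> real"
  assumes V: "\<And>k. 0 \<le> V k" and w: "\<And>k. 0 \<le> w k" and c: "c > 0"
    and step: "\<And>k. V (Suc k) \<le> V k - c * w k"
  shows "decseq V" and "convergent V" and "w \<longlonglongrightarrow> 0"
proof -
  show dec: "decseq V"
    unfolding decseq_Suc_iff using step w c by (smt (verit) mult_nonneg_nonneg)
  obtain l where l: "V \<longlonglongrightarrow> l"
    using decseq_convergent[OF dec, of 0] V by blast
  then show "convergent V" by (rule convergentI)
  have "(\<lambda>k. (V k - V (Suc k)) / c) \<longlonglongrightarrow> (l - l) / c"
    by (intro tendsto_intros l LIMSEQ_Suc) (use c in auto)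
  then have lim: "(\<lambda>k. (V k - V (Suc k)) / c) \<longlonglongrightarrow> 0" by simp
  show "w \<longlonglongrightarrow> 0"
  proof (rule tendsto_sandwich[OF _ _ tendsto_const lim])
    show "\<forall>\<^sub>F k in sequentially. w k \<le> (V k - V (Suc k)) / c"
      using step c by (intro always_eventually) (auto simp: field_simps)
  qed (use w in auto)
qed

section \<open>Weak limits of points of two graphs\<close>

lemma tendsto_inner_zero_bounded:
  fixes s x :: "'i \<Rightarrow> 'a::real_inner"
  assumes s: "(s \<longlongrightarrow> 0) F" and x: "bounded (range x)"
  shows "((\<lambda>k. inner (s k) (x k)) \<longlongrightarrow> 0) F"
proof -
  obtain C where C: "\<And>k. norm (x k) \<le> C" using x by (auto simp: bounded_iff)
  show ?thesis
  proof (rule Lim_null_comparison)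
    show "\<forall>\<^sub>F k in F. norm (inner (s k) (x k)) \<le> norm (s k) * C"
      by (intro always_eventually allI)
         (simp add: order_trans[OF Cauchy_Schwarz_ineq2 mult_left_mono[OF C]])
    show "((\<lambda>k. norm (s k) * C) \<longlongrightarrow> 0) F"
      using tendsto_mult[OF tendsto_norm[OF s] tendsto_const, of C] by simp
  qed
qed

text \<open>Testing monotonicity at points \<open>(u, v)\<close> of \<open>A\<close> and \<open>(p, q)\<close> of \<open>B\<close> with
  \<open>u + v = l + m\<close> and \<open>p + q = l - m\<close>, provided by Minty's theorem, bounds
  \<open>\<parallel>l - u\<parallel>\<^sup>2 + \<parallel>l - p\<parallel>\<^sup>2\<close> by zero.\<close>

lemma weak_cluster_point_zero:
  fixes A B :: "'a::{real_inner, complete_space} setop" and x a y b :: "'i \<Rightarrow> 'a"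
  assumes A: "maximally_monotone A" and B: "maximally_monotone B"
    and a: "\<And>k. a k \<in> A (x k)" and b: "\<And>k. b k \<in> B (y k)"
    and bdd: "bounded (range x)" "bounded (range a)"
    and xy: "((\<lambda>k. x k - y k) \<longlongrightarrow> 0) F" and ab: "((\<lambda>k. a k + b k) \<longlongrightarrow> 0) F"
    and F: "F \<noteq> bot" and x_lim: "weakly_tendsto x l F" and a_lim: "weakly_tendsto a m F"
  shows "m \<in> A l" and "- m \<in> B l"
proof -
  obtain u v where uv: "v \<in> A u" "l + m = u + 1 *\<^sub>R v" using minty[OF A zero_less_one, of "l + m"] by blast
  obtain p q where pq: "q \<in> B p" "l - m = p + 1 *\<^sub>R q" using minty[OF B zero_less_one, of "l - m"] by blast
  have v: "v = l + m - u" and q: "q = l - m - p" using uv(2) pq(2) by (simp_all add: algebra_simps)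
  let ?d = "\<lambda>k. x k - y k" and ?s = "\<lambda>k. a k + b k"
  \<comment> \<open>Writing y = x - d and b = s - a cancels <a, x>, the product of two merely weakly
    convergent families. What remains is weakly continuous or contains a factor tending to 0 in
    norm.\<close>
  let ?E = "\<lambda>k. inner v u + inner q p - inner (a k) (u - p) - inner (x k) (v + q)
      + inner (?s k) (x k) + inner (?d k) (a k) - inner (?s k) (?d k) - inner (?s k) p + inner (?d k) q"
  have E: "0 \<le> ?E k" for k
  proof -
    have "0 \<le> inner (a k - v) (x k - u) + inner (b k - q) (y k - p)"
      using A B a b uv(1) pq(1)
      by (intro add_nonneg_nonneg monotone_opD) (auto simp: maximally_monotone_def)
    also have "\<dots> = ?E k"
      by (simp add: inner_add_left inner_add_right inner_diff_left inner_diff_right inner_commute)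
    finally show ?thesis .
  qed
  have E_lim: "(?E \<longlongrightarrow> inner v u + inner q p - inner m (u - p) - inner l (v + q)
      + 0 + 0 - inner (0 :: 'a) 0 - inner 0 p + inner 0 q) F"
    by (intro tendsto_add tendsto_diff tendsto_const x_lim[unfolded weakly_tendsto_def, rule_format]
        a_lim[unfolded weakly_tendsto_def, rule_format] tendsto_inner_zero_bounded[OF ab bdd(1)]
        tendsto_inner_zero_bounded[OF xy bdd(2)] tendsto_inner[OF ab xy]
        tendsto_inner[OF ab tendsto_const] tendsto_inner[OF xy tendsto_const])
  have "0 \<le> inner v u + inner q p - inner m (u - p) - inner l (v + q)"
    using tendsto_lowerbound[OF E_lim always_eventually[OF allI, OF E] F] by simp
  also have "\<dots> = - (inner (l - u) (l - u) + inner (l - p) (l - p))"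
    unfolding v q
    by (simp add: inner_add_left inner_add_right inner_diff_left inner_diff_right inner_commute)
  finally have "inner (l - u) (l - u) + inner (l - p) (l - p) \<le> 0" by linarith
  then have "inner (l - u) (l - u) = 0" "inner (l - p) (l - p) = 0"
    using inner_ge_zero[of "l - u"] inner_ge_zero[of "l - p"] by linarith+
  then have "u = l" "p = l" by auto
  then show "m \<in> A l" "- m \<in> B l" using uv(1) pq(1) v q by auto
qed

section \<open>Weak convergence of the iterates in the admissible parameter range\<close>

lemma edr_weak_convergence:
  fixes f :: "'a::{real_inner, complete_space} \<Rightarrow> ereal" and B :: "'a setop"
  assumes f: "f \<in> proper_closed_convex" and B: "maximally_monotone B"
    and \<alpha>: "\<alpha> > 0" and \<beta>: "\<beta> > 0" and \<theta>: "0 < \<theta>" "\<theta> < 2" "\<theta> < 2 * \<alpha> / \<beta>"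
    and zer: "zer (op_add (subdiff f) B) \<noteq> {}"
  shows "\<exists>p\<in>edr_Fix (subdiff f) B \<alpha> \<beta>. weakly_converges (edr_seq (subdiff f) B z0 \<alpha> \<beta> \<theta>) p"
proof -
  let ?A = "subdiff f"
  have A: "maximally_monotone ?A"
    using subdiff_ops_subset_maxmono_ops f unfolding subdiff_ops_def maxmono_ops_def by blast
  have mono: "monotone_op ?A" "monotone_op B" using A B by (auto simp: maximally_monotone_def)
  define z where "z = edr_z ?A B z0 \<alpha> \<beta> \<theta>"
  define x where "x k = edr_x1 ?A \<alpha> (z k)" for k
  define y where "y k = edr_x2 ?A B \<alpha> \<beta> (z k)" for k
  define a where "a k = (1 / \<alpha>) *\<^sub>R (z k - x k)" for k
  \<comment> \<open>Since z k = x k + \<alpha> a k, the second resolvent is evaluated at x k -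
    \<beta> a k, and \<open>b k\<close> is its residual divided by \<beta>.\<close>
  define b where "b k = (1 / \<beta>) *\<^sub>R (x k - y k) - a k" for k
  define p where "p k = real_of_ereal (f (x k))" for k
  have a: "a k \<in> ?A (x k)" for k
    unfolding a_def x_def edr_x1_def by (rule resolvent_residual[OF A \<alpha>])
  have b: "b k \<in> B (y k)" for k
  proof -
    have "(1 / \<beta>) *\<^sub>R ((1 + \<beta> / \<alpha>) *\<^sub>R x k - (\<beta> / \<alpha>) *\<^sub>R z k - y k) \<in> B (y k)"
      unfolding y_def x_def edr_x2_def by (rule resolvent_residual[OF B \<beta>])
    also have "(1 / \<beta>) *\<^sub>R ((1 + \<beta> / \<alpha>) *\<^sub>R x k - (\<beta> / \<alpha>) *\<^sub>R z k - y k) = b k"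
      using \<beta> by (simp add: b_def a_def algebra_simps)
    finally show ?thesis .
  qed
  have z_eq: "z k = x k + \<alpha> *\<^sub>R a k" for k using \<alpha> by (simp add: a_def)
  have z_Suc: "z (Suc k) = z k - \<theta> *\<^sub>R (x k - y k)" for k
    by (simp add: z_def x_def y_def algebra_simps)
  have xy: "x k - y k = \<beta> *\<^sub>R (a k + b k)" for k using \<beta> by (simp add: b_def)
  \<comment> \<open>The solution \<open>(xs, as)\<close> remains a parameter, because the functions
    of two solutions are compared below.\<close>
  define V where "V = (\<lambda>xs as k. (norm ((x k - xs) + \<alpha> *\<^sub>R (a k - as)))\<^sup>2
    + 2 * (\<beta> - \<alpha>) * (p k - real_of_ereal (f xs) - inner as (x k - xs))
    + \<alpha> * (\<beta> - \<alpha>) * (norm (a k - as))\<^sup>2)"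
  define c where "c = \<theta> * (2 - \<theta> * max 1 (\<beta> / \<alpha>))"
  \<comment> \<open>Both upper bounds on \<theta> enter here.\<close>
  have c: "c > 0"
  proof -
    have "\<theta> * (\<beta> / \<alpha>) < 2" using \<theta> \<alpha> \<beta> by (simp add: field_simps)
    then show ?thesis using \<theta> unfolding c_def max_def by auto
  qed
  have V_step: "V xs as (Suc k) \<le> V xs as k - c * (norm (x k - y k))\<^sup>2"
    if s: "as \<in> ?A xs" "- as \<in> B xs" for xs as k
  proof -
    have "(norm ((x (Suc k) - xs) + \<alpha> *\<^sub>R (a (Suc k) - as)))\<^sup>2
        + 2 * (\<beta> - \<alpha>) * (p (Suc k) - real_of_ereal (f xs) - inner as (x (Suc k) - xs))
        + \<alpha> * (\<beta> - \<alpha>) * (norm (a (Suc k) - as))\<^sup>2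
      \<le> (norm ((x k - xs) + \<alpha> *\<^sub>R (a k - as)))\<^sup>2
        + 2 * (\<beta> - \<alpha>) * (p k - real_of_ereal (f xs) - inner as (x k - xs))
        + \<alpha> * (\<beta> - \<alpha>) * (norm (a k - as))\<^sup>2
        - \<theta> * (2 - \<theta> * max 1 (\<beta> / \<alpha>)) * (norm ((x k - xs) - (y k - xs)))\<^sup>2"
    proof (rule lyapunov_decrease[where b = "b k - (- as)"])
      show "x k - xs - (y k - xs) = \<beta> *\<^sub>R (a k - as + (b k - - as))"
        by (simp add: xy)
      show "0 \<le> inner (a k - as) (x k - xs) + inner (b k - - as) (y k - xs)"
        by (intro add_nonneg_nonneg monotone_opD[OF mono(1) a s(1)] monotone_opD[OF mono(2) b s(2)])
      show "x (Suc k) - xs + \<alpha> *\<^sub>R (a (Suc k) - as)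
          = x k - xs + \<alpha> *\<^sub>R (a k - as) - \<theta> *\<^sub>R (x k - xs - (y k - xs))"
        using z_Suc[of k] by (simp add: z_eq algebra_simps)
      show "p k - real_of_ereal (f xs) - inner as (x k - xs)
            + inner (a k - as) (x (Suc k) - xs - (x k - xs))
          \<le> p (Suc k) - real_of_ereal (f xs) - inner as (x (Suc k) - xs)"
        using subdiff_ineq[OF f a[of k] a[of "Suc k"]]
        by (simp add: p_def inner_diff_left inner_diff_right)
      show "p (Suc k) - real_of_ereal (f xs) - inner as (x (Suc k) - xs)
            + inner (a (Suc k) - as) (x k - xs - (x (Suc k) - xs))
          \<le> p k - real_of_ereal (f xs) - inner as (x k - xs)"
        using subdiff_ineq[OF f a[of "Suc k"] a[of k]]
        by (simp add: p_def inner_diff_left inner_diff_right)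
    qed (use \<alpha> \<beta> \<theta> in auto)
    then show ?thesis by (simp add: V_def c_def)
  qed
  have V_coercive: "(norm (x k - xs))\<^sup>2 + \<alpha> * \<beta> * (norm (a k - as))\<^sup>2 \<le> V xs as k"
    if s: "as \<in> ?A xs" for xs as k
    unfolding V_def
  proof (rule lyapunov_coercive[OF \<alpha> \<beta>])
    show "0 \<le> p k - real_of_ereal (f xs) - inner as (x k - xs)"
      using subdiff_ineq[OF f s a[of k]] by (simp add: p_def)
    show "p k - real_of_ereal (f xs) - inner as (x k - xs) \<le> inner (a k - as) (x k - xs)"
      using subdiff_ineq[OF f a[of k] s]
      by (simp add: p_def inner_diff_left inner_diff_right)
  qed
  have V_nonneg: "0 \<le> V xs as k" if "as \<in> ?A xs" for xs as k
    by (rule order_trans[OF _ V_coercive[OF that]]) (use \<alpha> \<beta> in simp)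
  have descent: "decseq (V xs as)" "convergent (V xs as)" "(\<lambda>k. (norm (x k - y k))\<^sup>2) \<longlonglongrightarrow> 0"
    if s: "as \<in> ?A xs" "- as \<in> B xs" for xs as
    by (rule descent_sequence[where V = "V xs as", OF V_nonneg[OF s(1)] zero_le_power2 c V_step[OF s]])+

  obtain xs as where s: "as \<in> ?A xs" "- as \<in> B xs"
    using zer by (fastforce simp: zer_def op_add_def add_eq_0_iff)
  have "(\<lambda>k. (norm (x k - y k))\<^sup>2) \<longlonglongrightarrow> 0" using descent(3)[OF s] .
  then have xy_lim: "(\<lambda>k. x k - y k) \<longlonglongrightarrow> 0"
    by (simp add: tendsto_norm_zero_iff)
  have ab_lim: "(\<lambda>k. a k + b k) \<longlonglongrightarrow> 0"
    using tendsto_scaleR[OF tendsto_const xy_lim, of "1 / \<beta>"] by (simp add: b_def)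
  have V0: "V xs as k \<le> V xs as 0" for k
    using descent(1)[OF s] by (simp add: decseq_def)
  have "norm (x k) \<le> norm xs + sqrt (V xs as 0)"
    and "norm (a k) \<le> norm as + sqrt (V xs as 0 / (\<alpha> * \<beta>))" for k
  proof -
    have *: "(norm (x k - xs))\<^sup>2 + \<alpha> * \<beta> * (norm (a k - as))\<^sup>2 \<le> V xs as 0"
      using V_coercive[OF s(1)] V0 by (rule order_trans)
    have "(norm (x k - xs))\<^sup>2 \<le> V xs as 0"
      by (rule order_trans[OF _ *]) (use \<alpha> \<beta> in simp)
    moreover have "\<alpha> * \<beta> * (norm (a k - as))\<^sup>2 \<le> V xs as 0"
      by (rule order_trans[OF _ *]) simp
    then have "(norm (a k - as))\<^sup>2 \<le> V xs as 0 / (\<alpha> * \<beta>)"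
      using \<alpha> \<beta> by (simp add: field_simps)
    ultimately have "norm (x k - xs) \<le> sqrt (V xs as 0)"
      "norm (a k - as) \<le> sqrt (V xs as 0 / (\<alpha> * \<beta>))" by (simp_all add: real_le_rsqrt)
    then show "norm (x k) \<le> norm xs + sqrt (V xs as 0)"
      "norm (a k) \<le> norm as + sqrt (V xs as 0 / (\<alpha> * \<beta>))"
      using norm_triangle_sub[of "x k" xs] norm_triangle_sub[of "a k" as] by linarith+
  qed
  then have bdd: "bounded (range x)" "bounded (range a)" by (auto simp: bounded_iff)
  have "bounded (range x \<times> range a)" using bdd by (rule bounded_Times)
  \<comment> \<open>Passing to pairs in the product space yields cluster points of x and a along one
    common filter.\<close>
  then have bdd_pair: "bounded (range (\<lambda>k. (x k, a k)))" by (rule bounded_subset) auto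

  have fst_snd: "weakly_tendsto x l F" "weakly_tendsto a m F"
    if "weakly_tendsto (\<lambda>k. (x k, a k)) (l, m) F" for l m F
  proof -
    have "((\<lambda>k. inner (x k, a k) (u, v)) \<longlongrightarrow> inner (l, m) (u, v)) F" for u v
      using that unfolding weakly_tendsto_def by blast
    from this[of _ 0] this[of 0] show "weakly_tendsto x l F" "weakly_tendsto a m F"
      by (simp_all add: weakly_tendsto_def)
  qed
  have cluster: "m \<in> ?A l" "- m \<in> B l"
    if "F \<le> sequentially" "F \<noteq> bot" "weakly_tendsto (\<lambda>k. (x k, a k)) (l, m) F" for l m F
    using weak_cluster_point_zero[OF A B a b bdd tendsto_mono[OF that(1) xy_lim]
        tendsto_mono[OF that(1) ab_lim] that(2) fst_snd[OF that(3)]] .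

  have V_diff: "convergent (\<lambda>k. inner (z k) ((l + \<beta> *\<^sub>R m) - (l' + \<beta> *\<^sub>R m')))"
    if s: "m \<in> ?A l" "- m \<in> B l" and s': "m' \<in> ?A l'" "- m' \<in> B l'" for l m l' m'
  proof -
    define C where "C l m = (norm (l + \<alpha> *\<^sub>R m))\<^sup>2 - 2 * (\<beta> - \<alpha>) * (real_of_ereal (f l) - inner m l)
      + \<alpha> * (\<beta> - \<alpha>) * (norm m)\<^sup>2" for l m
    \<comment> \<open>The linear terms in x k and a k combine to a multiple of z k = x k + \<alpha>
      a k, which changes the coefficient of m from \<alpha> to \<beta>. The remaining nonconstant
      terms are the same for all solutions and cancel in differences.\<close>
    have V_eq: "V l m k = (norm (z k))\<^sup>2 + 2 * (\<beta> - \<alpha>) * p k + \<alpha> * (\<beta> - \<alpha>) * (norm (a k))\<^sup>2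
        - 2 * inner (z k) (l + \<beta> *\<^sub>R m) + C l m" for l m k
      unfolding V_def C_def z_eq power2_norm_eq_inner
      by (simp add: inner_add_left inner_add_right inner_diff_left inner_diff_right inner_commute
          algebra_simps)
    have "(\<lambda>k. inner (z k) ((l + \<beta> *\<^sub>R m) - (l' + \<beta> *\<^sub>R m')))
        = (\<lambda>k. (V l' m' k - V l m k + (C l m - C l' m')) / 2)"
      by (rule ext) (simp add: V_eq inner_diff_right field_simps)
    moreover obtain t t' where "V l m \<longlonglongrightarrow> t" "V l' m' \<longlonglongrightarrow> t'"
      using descent(2)[OF s] descent(2)[OF s'] by (auto simp: convergent_def)
    then have "(\<lambda>k. (V l' m' k - V l m k + (C l m - C l' m')) / 2)
        \<longlonglongrightarrow> (t' - t + (C l m - C l' m')) / 2"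
      by (intro tendsto_intros) auto
    ultimately show ?thesis by (simp add: convergentI)
  qed
  have z_lim: "((\<lambda>k. inner (z k) w) \<longlongrightarrow> inner (l + \<alpha> *\<^sub>R m) w) F"
    if "weakly_tendsto (\<lambda>k. (x k, a k)) (l, m) F" for l m w F
    unfolding z_eq inner_add_left inner_scaleR_left
    by (intro tendsto_add tendsto_mult tendsto_const
        fst_snd[OF that, unfolded weakly_tendsto_def, rule_format])
  have unique: "q = q'"
    if F: "F \<le> sequentially" "F \<noteq> bot" "weakly_tendsto (\<lambda>k. (x k, a k)) q F"
      and F': "F' \<le> sequentially" "F' \<noteq> bot" "weakly_tendsto (\<lambda>k. (x k, a k)) q' F'" for F F' q q'
  proof -
    obtain l m l' m' where q: "q = (l, m)" "q' = (l', m')" by (metis surj_pair)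
    note lm = cluster[OF F[unfolded q]] and lm' = cluster[OF F'[unfolded q]]
    let ?w = "(l + \<beta> *\<^sub>R m) - (l' + \<beta> *\<^sub>R m')"
    obtain t where t: "(\<lambda>k. inner (z k) ?w) \<longlonglongrightarrow> t"
      using V_diff[OF lm lm'] by (auto simp: convergent_def)
    have "inner (l + \<alpha> *\<^sub>R m) ?w = t"
      by (rule tendsto_unique[OF F(2) z_lim[OF F(3)[unfolded q]] tendsto_mono[OF F(1) t]])
    moreover have "inner (l' + \<alpha> *\<^sub>R m') ?w = t"
      by (rule tendsto_unique[OF F'(2) z_lim[OF F'(3)[unfolded q]] tendsto_mono[OF F'(1) t]])
    ultimately have "inner ((l + \<alpha> *\<^sub>R m) - (l' + \<alpha> *\<^sub>R m')) ?w = 0"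
      by (simp add: inner_diff_left)
    \<comment> \<open>The vanishing inner product is a sum of three nonnegative terms, the middle
      one by monotonicity, so both differences are zero.\<close>
    moreover have "inner ((l + \<alpha> *\<^sub>R m) - (l' + \<alpha> *\<^sub>R m')) ?w
        = inner (l - l') (l - l') + (\<alpha> + \<beta>) * inner (m - m') (l - l')
          + \<alpha> * \<beta> * inner (m - m') (m - m')"
      by (simp add: inner_add_left inner_add_right inner_diff_left inner_diff_right inner_commute
          algebra_simps)
    moreover have "0 \<le> (\<alpha> + \<beta>) * inner (m - m') (l - l')"
      using monotone_opD[OF mono(1) lm(1) lm'(1)] \<alpha> \<beta> by simp
    moreover have "0 \<le> \<alpha> * \<beta> * inner (m - m') (m - m')" using \<alpha> \<beta> by simp
    ultimately have "inner (l - l') (l - l') = 0" "\<alpha> * \<beta> * inner (m - m') (m - m') = 0"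
      using inner_ge_zero[of "l - l'"] by linarith+
    then show ?thesis using q \<alpha> \<beta> by simp
  qed
  obtain q F where F: "F \<le> sequentially" "F \<noteq> bot" "weakly_tendsto (\<lambda>k. (x k, a k)) q F"
    and q: "weakly_converges (\<lambda>k. (x k, a k)) q"
    by (rule weakly_convergesI_unique_cluster[OF bdd_pair], erule (5) unique, blast)
  obtain l m where lm: "q = (l, m)" by (metis surj_pair)
  have zero: "m \<in> ?A l" "- m \<in> B l" using cluster[OF F[unfolded lm]] .
  have lim: "weakly_tendsto (\<lambda>k. (x k, a k)) (l, m) sequentially"
    using q by (simp add: lm weakly_tendsto_def weakly_converges_def)
  have "l = resolvent \<alpha> ?A (l + \<alpha> *\<^sub>R m)"
    by (rule resolvent_eqI[OF mono(1) \<alpha> zero(1) refl, symmetric])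
  moreover have "l = resolvent \<beta> B ((1 + \<beta> / \<alpha>) *\<^sub>R l - (\<beta> / \<alpha>) *\<^sub>R (l + \<alpha> *\<^sub>R m))"
    by (rule resolvent_eqI[OF mono(2) \<beta> zero(2), symmetric]) (use \<alpha> in \<open>simp add: algebra_simps\<close>)
  ultimately have "(l, l, l + \<alpha> *\<^sub>R m) \<in> edr_Fix ?A B \<alpha> \<beta>" unfolding edr_Fix_def by blast
  moreover have "weakly_converges (edr_seq ?A B z0 \<alpha> \<beta> \<theta>) (l, l, l + \<alpha> *\<^sub>R m)"
    unfolding weakly_converges_def
  proof
    fix w :: "'a \<times> 'a \<times> 'a"
    obtain u v r where w: "w = (u, v, r)" by (metis surj_pair)
    \<comment> \<open>The second component is written as x k minus a residual tending to 0 in norm,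
      so it has the weak limit of x k.\<close>
    have "inner (edr_seq ?A B z0 \<alpha> \<beta> \<theta> k) w
        = inner (x k) u + (inner (x k) v - inner (x k - y k) v + inner (z k) r)" for k
      by (simp add: edr_seq_def Let_def w x_def y_def z_def inner_diff_left)
    moreover have "(\<lambda>k. inner (x k) u + (inner (x k) v - inner (x k - y k) v + inner (z k) r))
        \<longlonglongrightarrow> inner l u + (inner l v - inner 0 v + inner (l + \<alpha> *\<^sub>R m) r)"
      by (intro tendsto_add tendsto_diff z_lim[OF lim] tendsto_inner[OF xy_lim tendsto_const]
          fst_snd(1)[OF lim, unfolded weakly_tendsto_def, rule_format])
    ultimately show "(\<lambda>k. inner (edr_seq ?A B z0 \<alpha> \<beta> \<theta> k) w)
        \<longlonglongrightarrow> inner (l, l, l + \<alpha> *\<^sub>R m) w"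
      by (simp add: w)
  qed
  ultimately show ?thesis by blast
qed

subsection \<open>Necessity of the parameter range\<close>

text \<open>Chosen for its subdifferential, whose resolvent is constantly 0; the zero function is
  paired with it because its resolvent is the identity.\<close>

abbreviation ind0 :: "'a::real_inner \<Rightarrow> ereal" where
  "ind0 \<equiv> \<lambda>x. if x = 0 then 0 else \<infinity>"

lemma const_proper_closed_convex:
  "(\<lambda>_. 0) \<in> (proper_closed_convex :: ('a::real_inner \<Rightarrow> ereal) set)"
  unfolding proper_closed_convex_def proper_fun_def lsc_fun_iff_eventually_nhds convex_fun_def by auto

lemma ind0_proper_closed_convex: "(ind0 :: 'a::real_inner \<Rightarrow> ereal) \<in> proper_closed_convex"
proof -
  have "proper_fun (ind0 :: 'a \<Rightarrow> ereal)" by (auto simp: proper_fun_def)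
  moreover have "lsc_fun (ind0 :: 'a \<Rightarrow> ereal)"
    unfolding lsc_fun_iff_eventually_nhds
  proof (intro allI impI)
    fix x :: 'a and c assume c: "c < ind0 x"
    show "\<forall>\<^sub>F y in nhds x. c < ind0 y"
    proof (cases "x = 0")
      case True
      with c have "c < ind0 y" for y :: 'a by (auto intro: less_le_trans)
      then show ?thesis by (rule always_eventually[OF allI])
    next
      case False
      then have "\<forall>\<^sub>F y in nhds x. y \<noteq> 0" by (rule t1_space_nhds)
      then show ?thesis by eventually_elim (use c False in auto)
    qed
  qed
  moreover have "convex_fun (ind0 :: 'a \<Rightarrow> ereal)"
    unfolding convex_fun_def by auto
  ultimately show ?thesis by (simp add: proper_closed_convex_def)
qed

lemma subdiff_zero: "subdiff (\<lambda>_. 0) = (\<lambda>x::'a::real_inner. {0})"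
proof (intro ext set_eqI iffI)
  fix x u :: 'a assume "u \<in> subdiff (\<lambda>_. 0) x"
  then have "inner u (y - x) \<le> 0" for y by (simp add: subdiff_def)
  from this[of "x + u"] have "inner u u \<le> 0" by simp
  then show "u \<in> {0}" by (metis inner_eq_zero_iff inner_ge_zero order_antisym singletonI)
qed (simp add: subdiff_def)

lemma subdiff_ind0: "subdiff ind0 = (\<lambda>x::'a::real_inner. if x = 0 then UNIV else {})"
  by (intro ext) (auto simp: subdiff_def)

lemma resolvent_zero: "resolvent \<alpha> (\<lambda>_. {0}) z = z"
  by (simp add: resolvent_def)

lemma resolvent_ind0:
  assumes "\<alpha> > 0"
  shows "resolvent \<alpha> (\<lambda>x. if x = 0 then UNIV else {}) z = 0"
proof -
  have "\<exists>u. z = \<alpha> *\<^sub>R u" using assms by (intro exI[of _ "(1 / \<alpha>) *\<^sub>R z"]) simp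
  then show ?thesis unfolding resolvent_def by (intro the_equality) (auto split: if_splits)
qed

lemma geometric_tendsto_zeroD:
  fixes r c :: real
  assumes "(\<lambda>k. r ^ k * c) \<longlonglongrightarrow> 0" "c \<noteq> 0"
  shows "\<bar>r\<bar> < 1"
proof (rule ccontr)
  assume r: "\<not> \<bar>r\<bar> < 1"
  have "\<forall>\<^sub>F k in sequentially. norm (r ^ k * c) < norm c"
    by (rule order_tendstoD(2)[OF tendsto_norm_zero[OF assms(1)]]) (use assms(2) in simp)
  moreover have "\<not> norm (r ^ k * c) < norm c" for k
    using r mult_right_mono[OF one_le_power[of "\<bar>r\<bar>" k], of "\<bar>c\<bar>"]
    by (simp add: abs_mult power_abs)
  ultimately show False by simp
qed

text \<open>In both orders (0, 0, 0) is the only fixed point, so z must tend weakly to 0. The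
  iterates are multiples of e, and testing the last component against e leaves a real geometric
  sequence.\<close>

lemma edr_necessary:
  assumes e: "(e :: 'a::{real_inner, complete_space}) \<noteq> 0"
    and \<alpha>: "\<alpha> > 0" and \<beta>: "\<beta> > 0"
    and conv: "converges_unconditionally (subdiff_ops \<times> (subdiff_ops :: 'a setop set)) \<alpha> \<beta> \<theta>"
  shows "\<bar>1 - \<theta>\<bar> < 1" and "\<bar>1 - \<theta> * (\<beta> / \<alpha>)\<bar> < 1"
proof -
  let ?O = "(\<lambda>_. {0}) :: 'a setop" and ?N = "(\<lambda>x. if x = 0 then UNIV else {}) :: 'a setop"
  have ops: "?O \<in> subdiff_ops" "?N \<in> subdiff_ops"
    unfolding subdiff_ops_def
    using imageI[OF const_proper_closed_convex, of subdiff] imageI[OF ind0_proper_closed_convex, of subdiff]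
    by (simp_all only: subdiff_zero subdiff_ind0)
  have zer: "zer (op_add ?O ?N) \<noteq> {}" "zer (op_add ?N ?O) \<noteq> {}"
    by (auto simp: zer_def op_add_def intro!: exI[of _ 0])
  have z_lim: "(\<lambda>k. inner (edr_z A B e \<alpha> \<beta> \<theta> k) e) \<longlonglongrightarrow> 0"
    if "weakly_converges (edr_seq A B e \<alpha> \<beta> \<theta>) (x, x, 0)" for A B and x :: 'a
    using that[unfolded weakly_converges_def, rule_format, of "(0, 0, e)"]
    by (simp add: edr_seq_def Let_def)
  show "\<bar>1 - \<theta>\<bar> < 1"
  proof (rule geometric_tendsto_zeroD[where c = "inner e e"])
    obtain p where p: "p \<in> edr_Fix ?O ?N \<alpha> \<beta>" "weakly_converges (edr_seq ?O ?N e \<alpha> \<beta> \<theta>) p"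
      using conv ops zer unfolding converges_unconditionally_def by blast
    then have "weakly_converges (edr_seq ?O ?N e \<alpha> \<beta> \<theta>) (0, 0, 0)"
      using \<beta> by (auto simp: edr_Fix_def resolvent_zero resolvent_ind0)
    \<comment> \<open>Here x1 = z and x2 = 0.\<close>
    moreover have "edr_z ?O ?N e \<alpha> \<beta> \<theta> k = (1 - \<theta>) ^ k *\<^sub>R e" for k
      using \<beta> by (induction k) (simp_all add: edr_x1_def edr_x2_def resolvent_zero resolvent_ind0
          algebra_simps)
    ultimately show "(\<lambda>k. (1 - \<theta>) ^ k * inner e e) \<longlonglongrightarrow> 0"
      using z_lim by fastforce
  qed (use e in simp)
  show "\<bar>1 - \<theta> * (\<beta> / \<alpha>)\<bar> < 1"
  proof (rule geometric_tendsto_zeroD[where c = "inner e e"])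
    obtain p where p: "p \<in> edr_Fix ?N ?O \<alpha> \<beta>" "weakly_converges (edr_seq ?N ?O e \<alpha> \<beta> \<theta>) p"
      using conv ops zer unfolding converges_unconditionally_def by blast
    then have "weakly_converges (edr_seq ?N ?O e \<alpha> \<beta> \<theta>) (0, 0, 0)"
      using \<alpha> \<beta> by (auto simp: edr_Fix_def resolvent_zero resolvent_ind0)
    \<comment> \<open>Here x1 = 0 and x2 = -(\<beta>/\<alpha>) z.\<close>
    moreover have "edr_z ?N ?O e \<alpha> \<beta> \<theta> k = (1 - \<theta> * (\<beta> / \<alpha>)) ^ k *\<^sub>R e" for k
      using \<alpha> by (induction k) (simp_all add: edr_x1_def edr_x2_def resolvent_zero resolvent_ind0
          algebra_simps)
    ultimately show "(\<lambda>k. (1 - \<theta> * (\<beta> / \<alpha>)) ^ k * inner e e) \<longlonglongrightarrow> 0"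
      using z_lim by fastforce
  qed (use e in simp)
qed

theorem theorem3p3:
  assumes dim_ge_1: "\<exists>x :: 'a::{real_inner, complete_space}. x \<noteq> 0"
  shows "(\<forall>\<alpha> \<beta> \<theta> :: real. \<alpha> > 0 \<longrightarrow> \<beta> > 0 \<longrightarrow> \<theta> \<noteq> 0 \<longrightarrow>
            (converges_unconditionally (subdiff_ops \<times> (subdiff_ops :: 'a setop set)) \<alpha> \<beta> \<theta>
               \<longleftrightarrow> \<theta> \<in> {0<..<min 2 (2 * \<alpha> / \<beta>)}))
       \<and> S_conv (subdiff_ops \<times> (subdiff_ops :: 'a setop set))
           = S_conv (subdiff_ops \<times> (maxmono_ops :: 'a setop set))
       \<and> S_conv (subdiff_ops \<times> (maxmono_ops :: 'a setop set)) = S1 \<union> S2"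
proof -
  obtain e :: 'a where e: "e \<noteq> 0" using dim_ge_1 by blast
  let ?F = "subdiff_ops :: 'a setop set" and ?M = "maxmono_ops :: 'a setop set"
  have nec: "\<theta> \<in> {0<..<min 2 (2 * \<alpha> / \<beta>)}"
    if "converges_unconditionally (?F \<times> ?F) \<alpha> \<beta> \<theta>" "\<alpha> > 0" "\<beta> > 0" for \<alpha> \<beta> \<theta>
    using edr_necessary[OF e that(2,3,1)] that(2,3) by (auto simp: abs_less_iff field_simps)
  have suff: "converges_unconditionally (?F \<times> ?M) \<alpha> \<beta> \<theta>"
    if "\<theta> \<in> {0<..<min 2 (2 * \<alpha> / \<beta>)}" "\<alpha> > 0" "\<beta> > 0" for \<alpha> \<beta> \<theta>
    using that unfolding converges_unconditionally_def subdiff_ops_def maxmono_ops_def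
    by (auto intro!: edr_weak_convergence)
  \<comment> \<open>This closes the cycle: convergence for two subdifferentials gives the range, the
    range gives convergence for the larger class, and that class contains the smaller one.\<close>
  have mono: "converges_unconditionally (?F \<times> ?F) \<alpha> \<beta> \<theta>"
    if "converges_unconditionally (?F \<times> ?M) \<alpha> \<beta> \<theta>" for \<alpha> \<beta> \<theta>
    using that subdiff_ops_subset_maxmono_ops unfolding converges_unconditionally_def by blast
  \<comment> \<open>The sets \<open>S1\<close> and \<open>S2\<close> are the cases in which the
    minimum is 2 \<alpha>/\<beta> and 2 respectively; they overlap at \<alpha> = \<beta>.\<close>
  have S12: "(\<alpha>, \<beta>, \<theta>) \<in> S1 \<union> S2 \<longleftrightarrow> \<alpha> > 0 \<and> \<beta> > 0 \<and> \<theta> \<in> {0<..<min 2 (2 * \<alpha> / \<beta>)}"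
    for \<alpha> \<beta> \<theta> :: real
  proof (cases "\<alpha> > 0 \<and> \<beta> > 0")
    case True
    then show ?thesis
      by (cases "\<alpha> \<le> \<beta>") (auto simp: S1_def S2_def field_simps)
  qed (auto simp: S1_def S2_def)
  have F_iff: "converges_unconditionally (?F \<times> ?F) \<alpha> \<beta> \<theta> \<longleftrightarrow> \<theta> \<in> {0<..<min 2 (2 * \<alpha> / \<beta>)}"
    and M_iff: "converges_unconditionally (?F \<times> ?M) \<alpha> \<beta> \<theta> \<longleftrightarrow> \<theta> \<in> {0<..<min 2 (2 * \<alpha> / \<beta>)}"
    if "\<alpha> > 0" "\<beta> > 0" for \<alpha> \<beta> \<theta>
    using nec[OF _ that] suff[OF _ that] mono by blast+
  have S_iff: "S_conv C = S1 \<union> S2"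
    if "\<And>\<alpha> \<beta> \<theta>. \<alpha> > 0 \<Longrightarrow> \<beta> > 0 \<Longrightarrow>
      converges_unconditionally C \<alpha> \<beta> \<theta> \<longleftrightarrow> \<theta> \<in> {0<..<min 2 (2 * \<alpha> / \<beta>)}"
    for C :: "('a setop \<times> 'a setop) set"
  proof (intro set_eqI)
    fix t :: "real \<times> real \<times> real"
    obtain \<alpha> \<beta> \<theta> where t: "t = (\<alpha>, \<beta>, \<theta>)" by (metis surj_pair)
    have "t \<in> S_conv C \<longleftrightarrow> \<alpha> > 0 \<and> \<beta> > 0 \<and> \<theta> \<in> {0<..<min 2 (2 * \<alpha> / \<beta>)}"
      using that[of \<alpha> \<beta> \<theta>] by (auto simp: S_conv_def t)
    then show "t \<in> S_conv C \<longleftrightarrow> t \<in> S1 \<union> S2" unfolding t S12 .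
  qed
  have "S_conv (?F \<times> ?F) = S1 \<union> S2" by (rule S_iff) (rule F_iff)
  moreover have "S_conv (?F \<times> ?M) = S1 \<union> S2" by (rule S_iff) (rule M_iff)
  ultimately show ?thesis using F_iff by simp
qed

end
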